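(* Consider the Neumann problem $\partial u/\partial t=D(t)\Delta u+A(x,t)u+B(u,x,t)$ in $\Omega$, $\frac{\partial u}{\partial n}|_{\partial\Omega}=0$, $u(x,0)=u_0(x)$, with the assumptions and notation given in the context, and let $u$ be its solution. Suppose that $$\gamma(t)=-\frac{\gamma_0}{(t+1)^k},\qquad \mu(t)=\mu_0+\mu_1(t+1)^{-\nu},$$ where $\gamma_0,\mu_0,\mu_1>0$, $\nu>0$ and $k$ are constants with $\nu+1\le k$, that $\mu_0+\mu_1=g(0)^{-1}$, and that for all $t\ge0$ $$\alpha(t)\le\left(\mu_0+\mu_1(t+1)^{-\nu}\right)^{q-1}\left(\frac{\nu\mu_1(1+t)^{-\nu-1}}{\mu_0+\mu_1(t+1)^{-\nu}}-\frac{\gamma_0}{(t+1)^k}\right)$$ and $$C(t)\,(1+t)^{\nu+1}c_0(t)\le\mu_0^{q-1}\left(\frac{\nu\mu_1}{\mu_0}-\gamma_0\right),\qquad C(t):=c^{p-1}\|u(\cdot,t)\|_{H^2(\Omega)}^{3(p-1)/4}.$$ Then $$\|u(\cdot,t)\|\le[\mu(t)]^{-1}\le\mu_0^{-1}\qquad\text{for all } t\ge0 .$$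
   Context: $\Omega\subset\mathbb R^{\mathcal M}$, $\mathcal M\le 3$, is a bounded domain with sufficiently smooth boundary; $u=(u_1,\dots,u_n)$ is $\mathbb R^n$-valued; $D(t)$ is a diagonal matrix with positive diagonal elements $d_i(t)$, and $d_i(t)\ge d(t)$ for $i=1,\dots,n$, $t\ge0$, where $d(t)$ is a positive function. The nonlinearity $F(u,x,t)=A(x,t)u+B(u,x,t)$, with $A(x,t)$ an $n\times n$ matrix, satisfies: $F(0,x,t)=0$ for $x\in\Omega$, $t\ge0$; $\sup_{u\in\mathbb R^n,\,x\in\mathbb R^{\mathcal M},\,t\ge0}|F(u,x,t)|\le M_1$ for a constant $M_1$; $|F(v,x,t)-F(w,x,s)|\le c_F(|t-s|+|v-w|)$ with a constant $c_F>0$ independent of $v,w,x,t,s$; $F$ is continuous in $x$. Moreover $\mathrm{Re}\,(A(x,t)u,u)\le-\gamma(t)|u|^2$ and $|B(u,x,t)|\le c_0(t)|u|^p$ with $p>1$, for all $u$, $x\in\Omega$, $t\ge0$, where $(\cdot,\cdot)$ is the inner product in $\mathbb R^n$, $|u|^2=\sum_{j=1}^n|u_j|^2$, and $\gamma$ is a real-valued function (not necessarily of constant sign). The initial function satisfies the compatibility condition $\frac{\partial u_0}{\partial n}=0$ on $\partial\Omega$. By the solution $u$ we mean the classical solution on $\Omega\times[0,\infty)$, with $u(\cdot,t)\in H^2(\Omega)$ for $t\ge0$. $\|\cdot\|$ is the $L^2(\Omega)$ norm and $g(t)=\|u(\cdot,t)\|$; it is assumed that $g(0)\ne0$. $c>0$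 is a constant, independent of $u$, such that $\|u\|_{L^\infty(\Omega)}\le c\,\|u\|_{L^2(\Omega)}^{1/4}\|u\|_{H^2(\Omega)}^{3/4}$ for all $u\in H^2(\Omega)$. Set $\alpha(t)=c_0(t)c^{p-1}\|u(\cdot,t)\|_{H^2(\Omega)}^{3(p-1)/4}=C(t)c_0(t)$, $q=(p+3)/4$; for the Neumann condition one sets $\sigma(t)=\gamma(t)$. The functions $\sigma(t)$ and $\alpha(t)\ge0$ are assumed continuous on $[0,\infty)$. *)

theory Defs
  imports "HOL-Analysis.Analysis" "HOL-Probability.Essential_Supremum"
begin

definition partial :: "'m::finite \<Rightarrow> (real^'m \<Rightarrow> 'b::real_normed_vector) \<Rightarrow> real^'m \<Rightarrow> 'b" where
  "partial i f x = frechet_derivative f (at x) (axis i 1)"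

text \<open>A list of coordinate directions plays the role of a multi-index; the order of
  differentiation is the length of the list.\<close>

fun partials :: "'m::finite list \<Rightarrow> (real^'m \<Rightarrow> 'b::real_normed_vector) \<Rightarrow> real^'m \<Rightarrow> 'b" where
  "partials [] f = f"
| "partials (j # js) f = partial j (partials js f)"

text \<open>Meant for open sets \<open>S\<close> only.\<close>

definition Ck_on :: "nat \<Rightarrow> (real^'m::finite) set \<Rightarrow> (real^'m \<Rightarrow> 'b::real_normed_vector) \<Rightarrow> bool" where
  "Ck_on k S f \<longleftrightarrow>
     (\<forall>js. length js < k \<longrightarrow> partials js f differentiable_on S) \<and>
     (\<forall>js. length js \<le> k \<longrightarrow> continuous_on S (partials js f))"

definition grad :: "(real^'m::finite \<Rightarrow> real) \<Rightarrow> real^'m \<Rightarrow> real^'m" where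
  "grad f x = (\<chi> i. partial i f x)"

definition laplacian :: "(real^'m::finite \<Rightarrow> 'b::real_normed_vector) \<Rightarrow> real^'m \<Rightarrow> 'b" where
  "laplacian f x = (\<Sum>i\<in>UNIV. partials [i, i] f x)"


definition local_defining_function ::
  "nat \<Rightarrow> (real^'m::finite) set \<Rightarrow> real^'m \<Rightarrow> (real^'m) set \<Rightarrow> (real^'m \<Rightarrow> real) \<Rightarrow> bool" where
  "local_defining_function k \<Omega> p U \<rho> \<longleftrightarrow>
     open U \<and> p \<in> U \<and> Ck_on k U \<rho> \<and> (\<forall>x\<in>U. grad \<rho> x \<noteq> 0) \<and>
     \<Omega> \<inter> U = {x \<in> U. \<rho> x < 0} \<and> frontier \<Omega> \<inter> U = {x \<in> U. \<rho> x = 0}"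

definition bounded_Ck_domain :: "nat \<Rightarrow> (real^'m::finite) set \<Rightarrow> bool" where
  "bounded_Ck_domain k \<Omega> \<longleftrightarrow>
     open \<Omega> \<and> connected \<Omega> \<and> \<Omega> \<noteq> {} \<and> bounded \<Omega> \<and>
     (\<forall>p\<in>frontier \<Omega>. \<exists>U \<rho>. local_defining_function k \<Omega> p U \<rho>)"

definition outward_unit_normal :: "(real^'m::finite) set \<Rightarrow> real^'m \<Rightarrow> real^'m \<Rightarrow> bool" where
  "outward_unit_normal \<Omega> p n \<longleftrightarrow>
     (\<exists>U \<rho>. local_defining_function 1 \<Omega> p U \<rho> \<and> n = grad \<rho> p /\<^sub>R norm (grad \<rho> p))"

text \<open>Normal derivative at a boundary point, as the one-sided derivative from inside \<open>\<Omega>\<close>, so that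
  only values on the closure of \<open>\<Omega>\<close> matter. At a boundary point of a \<open>C\<^sup>1\<close> domain
  the outward unit normal exists and is unique.\<close>

definition has_normal_derivative ::
  "(real^'m::finite) set \<Rightarrow> (real^'m \<Rightarrow> 'b::real_normed_vector) \<Rightarrow> real^'m \<Rightarrow> 'b \<Rightarrow> bool" where
  "has_normal_derivative \<Omega> v p l \<longleftrightarrow>
     (\<forall>n. outward_unit_normal \<Omega> p n \<longrightarrow>
        ((\<lambda>h. (v p - v (p - h *\<^sub>R n)) /\<^sub>R h) \<longlongrightarrow> l) (at_right 0))"


definition L2_on :: "(real^'m::finite) set \<Rightarrow> (real^'m \<Rightarrow> 'b::euclidean_space) \<Rightarrow> bool" where
  "L2_on \<Omega> v \<longleftrightarrow> v \<in> borel_measurable (lebesgue_on \<Omega>) \<and>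
     integrable (lebesgue_on \<Omega>) (\<lambda>x. (norm (v x))\<^sup>2)"

definition L2_norm :: "(real^'m::finite) set \<Rightarrow> (real^'m \<Rightarrow> 'b::euclidean_space) \<Rightarrow> real" where
  "L2_norm \<Omega> v = sqrt (\<integral>x. (norm (v x))\<^sup>2 \<partial>lebesgue_on \<Omega>)"

definition Linf_norm :: "(real^'m::finite) set \<Rightarrow> (real^'m \<Rightarrow> 'b::euclidean_space) \<Rightarrow> ereal" where
  "Linf_norm \<Omega> v = esssup (lebesgue_on \<Omega>) (\<lambda>x. ereal (norm (v x)))"

definition test_function :: "(real^'m::finite) set \<Rightarrow> (real^'m \<Rightarrow> real) \<Rightarrow> bool" where
  "test_function \<Omega> \<phi> \<longleftrightarrow> (\<forall>k. Ck_on k UNIV \<phi>) \<and>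
     compact (closure {x. \<phi> x \<noteq> 0}) \<and> closure {x. \<phi> x \<noteq> 0} \<subseteq> \<Omega>"

text \<open>\<open>w\<close> is an \<open>L\<^sup>2\<close> weak derivative of \<open>v\<close> with multi-index \<open>js\<close>.\<close>

definition L2_weak_deriv ::
  "(real^'m::finite) set \<Rightarrow> 'm list \<Rightarrow> (real^'m \<Rightarrow> 'b::euclidean_space) \<Rightarrow> (real^'m \<Rightarrow> 'b) \<Rightarrow> bool" where
  "L2_weak_deriv \<Omega> js v w \<longleftrightarrow> L2_on \<Omega> w \<and>
     (\<forall>\<phi>. test_function \<Omega> \<phi> \<longrightarrow>
        (\<integral>x. partials js \<phi> x *\<^sub>R v x \<partial>lebesgue_on \<Omega>) =
        (-1) ^ length js *\<^sub>R (\<integral>x. \<phi> x *\<^sub>R w x \<partial>lebesgue_on \<Omega>))"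

definition in_H2 :: "(real^'m::finite) set \<Rightarrow> (real^'m \<Rightarrow> 'b::euclidean_space) \<Rightarrow> bool" where
  "in_H2 \<Omega> v \<longleftrightarrow> L2_on \<Omega> v \<and> (\<forall>js. length js \<le> 2 \<longrightarrow> (\<exists>w. L2_weak_deriv \<Omega> js v w))"

text \<open>Weak derivatives are unique up to null sets, so the choice below does not affect the norm.
  Mixed second derivatives are counted once for each order, i.e.
  \<open>\<parallel>v\<parallel>\<^sup>2 + \<parallel>\<nabla>v\<parallel>\<^sup>2 + \<parallel>D\<^sup>2v\<parallel>\<^sup>2\<close> with the Frobenius norm of the Hessian.\<close>

definition H2_norm :: "(real^'m::finite) set \<Rightarrow> (real^'m \<Rightarrow> 'b::euclidean_space) \<Rightarrow> real" where
  "H2_norm \<Omega> v =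
     sqrt (\<Sum>js\<in>{js. length js \<le> 2}. (L2_norm \<Omega> (SOME w. L2_weak_deriv \<Omega> js v w))\<^sup>2)"


definition extends_continuously ::
  "'a::topological_space set \<Rightarrow> 'a set \<Rightarrow> ('a \<Rightarrow> 'b::topological_space) \<Rightarrow> bool" where
  "extends_continuously S T f \<longleftrightarrow> (\<exists>g. continuous_on T g \<and> (\<forall>z\<in>S. g z = f z))"

text \<open>Classical solution of
  \<open>u\<^sub>t = D(t)\<Delta>u + F(u,x,t)\<close> in \<open>\<Omega>\<close>, \<open>\<partial>u/\<partial>n = 0\<close> on the boundary, \<open>u(\<cdot>,0) = u0\<close>,
  where \<open>u t x\<close> stands for \<open>u(x,t)\<close>: \<open>u\<close> is continuous up to the boundary and up to
  \<open>t = 0\<close>; for \<open>t > 0\<close> it is \<open>C\<^sup>2\<close> in \<open>x\<close> and \<open>C\<^sup>1\<close> in \<open>t\<close>, with the first order derivatives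
  continuous up to the boundary and the second order ones continuous in the interior.\<close>

definition classical_neumann_solution ::
  "(real^'m::finite) set \<Rightarrow> (real \<Rightarrow> real^'n^'n) \<Rightarrow> (real^'n \<Rightarrow> real^'m \<Rightarrow> real \<Rightarrow> real^'n) \<Rightarrow>
   (real^'m \<Rightarrow> real^'n::finite) \<Rightarrow> (real \<Rightarrow> real^'m \<Rightarrow> real^'n) \<Rightarrow> bool" where
  "classical_neumann_solution \<Omega> D F u0 u \<longleftrightarrow>
     continuous_on ({0..} \<times> closure \<Omega>) (\<lambda>(t, x). u t x) \<and>
     (\<forall>t>0. \<forall>x\<in>\<Omega>. (\<lambda>s. u s x) differentiable (at t)) \<and>
     (\<forall>t>0. Ck_on 2 \<Omega> (u t)) \<and>
     extends_continuously ({0<..} \<times> \<Omega>) ({0<..} \<times> closure \<Omega>)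
       (\<lambda>(t, x). vector_derivative (\<lambda>s. u s x) (at t)) \<and>
     (\<forall>i. extends_continuously ({0<..} \<times> \<Omega>) ({0<..} \<times> closure \<Omega>) (\<lambda>(t, x). partial i (u t) x)) \<and>
     (\<forall>i j. continuous_on ({0<..} \<times> \<Omega>) (\<lambda>(t, x). partials [i, j] (u t) x)) \<and>
     (\<forall>t>0. \<forall>x\<in>\<Omega>. vector_derivative (\<lambda>s. u s x) (at t)
        = D t *v laplacian (u t) x + F (u t x) x t) \<and>
     (\<forall>t>0. \<forall>p\<in>frontier \<Omega>. has_normal_derivative \<Omega> (u t) p 0) \<and>
     (\<forall>x\<in>closure \<Omega>. u 0 x = u0 x)"

end

theory Submission
  imports Defs
begin

text \<open>Multiplying the equation by \<open>u\<close> and integrating gives, for \<open>y = \<parallel>u\<parallel>\<^sup>2\<close>,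
  \<open>y' \<le> - 2 \<gamma> y + 2 \<alpha> y\<^bsup>(q+1)/2\<^esup>\<close>: the diffusion term is nonpositive by Green's identity and the
  Neumann condition, and the term with \<open>B\<close> is estimated by interpolating the supremum norm. The hypothesis on
  \<open>\<alpha>\<close> says exactly that \<open>\<mu>\<^bsup>-2\<^esup>\<close> satisfies the reverse inequality, and the two functions agree at \<open>0\<close>.

  Green's identity needs the divergence theorem only for fields tangential to the boundary, where no surface
  measure occurs. Cut such a field off at distance \<open>\<epsilon>\<close> from the boundary: the error is the integral of
  \<open>V \<bullet> \<nabla>\<rho> / \<epsilon>\<close> over a layer of measure \<open>O(\<epsilon>)\<close>, on which \<open>V \<bullet> \<nabla>\<rho>\<close> is uniformly small.\<close>

section \<open>Integrals of derivatives and thin layers\<close>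

text \<open>The obstacle is regularity at the boundary. Second derivatives of a classical solution
  are continuous only inside \<open>\<Omega>\<close>, so Green's identity has to be reached with
  what does extend to the closure: \<open>u\<close>, its first derivatives and the time derivative.
  The normal component of the field is merely continuous there. It tends to 0 at the boundary
  without any rate, so it cannot make up for a loss in the layer estimate: the measure must be of
  the exact order \<open>\<epsilon>\<close> to balance the factor \<open>1 / \<epsilon>\<close> from
  the gradient of the cut-off. The energy is the square of the norm g, since g itself may fail to be
  differentiable where it vanishes. The exponent arises from |u|^(p+1) = |u|^(p-1) |u|^2: the
  interpolation inequality turns the supremum norm to the power p-1 into a factor g^((p-1)/4) =
  y^((p-1)/8), and 1 + (p-1)/8 = (q+1)/2. As this exponent is at least 1 and the comparison function
  is positive, the nonlinearity is Lipschitz wherever the comparison has to be made.\<close>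

lemma integral_directional_derivative_eq_0:
  fixes f f' :: "'a::euclidean_space \<Rightarrow> real" and e :: 'a
  assumes K: "compact K" and G: "open G" and KG: "K \<subseteq> G"
    and zero: "\<And>x. x \<notin> K \<Longrightarrow> f x = 0"
    and der: "\<And>x. x \<in> G \<Longrightarrow> ((\<lambda>s. f (x + s *\<^sub>R e)) has_real_derivative f' x) (at 0)"
    and cont: "continuous_on G f" "continuous_on G f'"
  shows "integral\<^sup>L (lebesgue_on G) f' = 0"
    and "integrable (lebesgue_on G) f'"
proof -
  define F' where "F' x = (if x \<in> G then f' x else 0)" for x
  have off: "((\<lambda>s. f (x + s *\<^sub>R e)) has_real_derivative 0) (at 0)" if "x \<notin> K" for x
  proof (rule has_field_derivative_transform_within_open)
    show "((\<lambda>s. 0) has_real_derivative 0) (at 0)" by simp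
    show "open ((\<lambda>s. x + s *\<^sub>R e) -` (- K))"
      by (intro open_vimage continuous_intros) (use K in \<open>auto simp: compact_imp_closed\<close>)
  qed (use that zero in auto)
  have F'_off: "F' x = 0" if "x \<notin> K" for x
    using DERIV_unique[OF off[OF that] der] by (auto simp: F'_def)
  have der': "((\<lambda>s. f (x + s *\<^sub>R e)) has_real_derivative F' x) (at 0)" for x
    using der[of x] off[of x] KG by (auto simp: F'_def)
  have derl: "((\<lambda>s. f (x + s *\<^sub>R e)) has_real_derivative F' (x + s *\<^sub>R e)) (at s)" for x s
  proof -
    have "((\<lambda>r. f ((x + s *\<^sub>R e) + (r - s) *\<^sub>R e)) has_real_derivative F' (x + s *\<^sub>R e) * 1) (at s)"
      by (rule DERIV_chain2[where f = "\<lambda>r. f ((x + s *\<^sub>R e) + r *\<^sub>R e)"])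
        (use der'[of "x + s *\<^sub>R e"] in \<open>auto intro!: derivative_eq_intros\<close>)
    moreover have "(\<lambda>r. f ((x + s *\<^sub>R e) + (r - s) *\<^sub>R e)) = (\<lambda>r. f (x + r *\<^sub>R e))"
      by (rule ext) (simp add: algebra_simps)
    ultimately show ?thesis by simp
  qed
  have "bounded (f' ` K)"
    using K KG cont(2) by (meson compact_continuous_image compact_imp_bounded continuous_on_subset)
  then obtain M where M: "M > 0" "\<And>x. x \<in> K \<Longrightarrow> \<bar>f' x\<bar> \<le> M"
    by (auto simp: bounded_pos)
  have F'_le: "\<bar>F' x\<bar> \<le> M" for x
    using M F'_off[of x] KG by (cases "x \<in> K") (auto simp: F'_def)
  have contf: "continuous_on UNIV f"
  proof -
    have "continuous_on (- K) f"
      by (rule continuous_on_eq[where f = "\<lambda>_. 0"]) (auto simp: zero)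
    then have "continuous_on (G \<union> - K) f"
      using K by (intro continuous_on_open_Un G cont) (auto simp: compact_imp_closed)
    moreover have "G \<union> - K = UNIV" using KG by auto
    ultimately show ?thesis by simp
  qed
  have intf: "integrable lborel f"
  proof -
    have "integrable lborel (\<lambda>x. indicator K x *\<^sub>R f x)"
      using borel_integrable_compact[OF K continuous_on_subset[OF contf]] by auto
    moreover have "(\<lambda>x. indicator K x *\<^sub>R f x) = f"
      using zero by (fastforce simp: indicator_def)
    ultimately show ?thesis by simp
  qed
  define h where "h n = inverse (real (Suc n))" for n
  have h: "h n > 0" "h n \<le> 1" for n by (auto simp: h_def field_simps)
  have h0: "h \<longlonglongrightarrow> 0" unfolding h_def by (rule LIMSEQ_inverse_real_of_nat)
  \<comment> \<open>Translation invariance of Lebesgue measure gives each difference quotient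
    integral 0, and dominated convergence passes this on to the derivative. Only the derivative in
    the direction \<open>e\<close> is involved, and no iterated integration.\<close>
  define Q where "Q n x = (f (x + h n *\<^sub>R e) - f x) / h n" for n x
  have intshift: "integrable lborel (\<lambda>x. f (x + v))" "(\<integral>x. f (x + v) \<partial>lborel) = integral\<^sup>L lborel f" for v
  proof -
    have *: "lborel = distr lborel borel (\<lambda>x. v + x)" by (simp add: lborel_distr_plus)
    have fm: "f \<in> borel_measurable borel" using contf by (rule borel_measurable_continuous_onI)
    show "integrable lborel (\<lambda>x. f (x + v))"
      using intf fm by (subst (asm) *) (simp add: integrable_distr_eq add.commute)
    show "(\<integral>x. f (x + v) \<partial>lborel) = integral\<^sup>L lborel f"
      using fm by (subst (2) *) (simp add: integral_distr add.commute)
  qed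
  have Q0: "integral\<^sup>L lborel (Q n) = 0" for n
    unfolding Q_def using intshift intf by simp
  obtain R where R: "\<And>x. x \<in> K \<Longrightarrow> norm x \<le> R"
    using compact_imp_bounded[OF K] by (auto simp: bounded_iff)
  have Qlim: "(\<lambda>n. Q n x) \<longlonglongrightarrow> F' x" for x
  proof -
    have "((\<lambda>s. (f (x + s *\<^sub>R e) - f x) / s) \<longlongrightarrow> F' x) (at 0)"
      using der'[of x] by (simp add: DERIV_def)
    moreover have "filterlim h (at 0) sequentially"
      using h0 h(1) by (auto simp: filterlim_at less_imp_neq[symmetric] intro!: always_eventually)
    ultimately show ?thesis unfolding Q_def by (rule filterlim_compose)
  qed
  \<comment> \<open>The mean value theorem on the segment from \<open>x\<close> to
    \<open>x + h n *\<^sub>R e\<close> bounds the quotient by \<open>M\<close>. Since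
    \<open>h n \<le> 1\<close>, all quotients are supported in one ball, which makes the majorant
    integrable.\<close>
  have Qle: "\<bar>Q n x\<bar> \<le> M * indicator (cball 0 (R + norm e)) x" for n x
  proof (cases "x \<in> cball 0 (R + norm e)")
    case True
    obtain z where "0 < z" "z < h n" and z: "f (x + h n *\<^sub>R e) - f (x + 0 *\<^sub>R e) = (h n - 0) * F' (x + z *\<^sub>R e)"
      using MVT2[of 0 "h n" "\<lambda>s. f (x + s *\<^sub>R e)" "\<lambda>s. F' (x + s *\<^sub>R e)"] derl h(1) by blast
    then have "Q n x = F' (x + z *\<^sub>R e)" using h(1)[of n] by (simp add: Q_def)
    then show ?thesis using True F'_le by simp
  next
    case False
    then have "x \<notin> K" using R[of x] norm_ge_zero[of e] by (auto simp: not_le simp del: norm_ge_zero)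
    moreover have "x + h n *\<^sub>R e \<notin> K"
    proof
      assume "x + h n *\<^sub>R e \<in> K"
      then have "norm (x + h n *\<^sub>R e) \<le> R" by (rule R)
      moreover have "norm x \<le> norm (x + h n *\<^sub>R e) + norm (h n *\<^sub>R e)"
        by (metis add_diff_cancel norm_triangle_ineq4)
      moreover have "norm (h n *\<^sub>R e) \<le> norm e" using h[of n] by (simp add: mult_left_le_one_le)
      ultimately show False using False by simp
    qed
    ultimately show ?thesis using zero M(1) by (simp add: Q_def)
  qed
  have Qm: "Q n \<in> borel_measurable lborel" for n
    using intshift(1) intf unfolding Q_def by (intro borel_measurable_divide borel_measurable_diff) auto
  have F'm: "F' \<in> borel_measurable lborel"
    using borel_measurable_LIMSEQ_real[OF Qlim Qm] by simp
  have dom: "integrable lborel (\<lambda>x. M * indicator (cball 0 (R + norm e)) x)"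
    using emeasure_lborel_cball_finite[of 0 "R + norm e"]
    by (intro integrable_mult_right integrable_real_indicator) auto
  have F'i: "integrable lborel F'"
    by (rule integrable_dominated_convergence[where s = Q, OF F'm Qm dom]) (use Qlim Qle in auto)
  have "(\<lambda>n. integral\<^sup>L lborel (Q n)) \<longlonglongrightarrow> integral\<^sup>L lborel F'"
    by (rule integral_dominated_convergence[where s = Q, OF F'm Qm dom]) (use Qlim Qle in auto)
  then have "integral\<^sup>L lborel F' = 0" using Q0 by (simp add: LIMSEQ_const_iff)
  moreover have "integral\<^sup>L (lebesgue_on G) f' = integral\<^sup>L lebesgue (\<lambda>x. indicator G x *\<^sub>R f' x)"
    using G by (intro integral_restrict_space) auto
  moreover have "(\<lambda>x. indicator G x *\<^sub>R f' x) = F'"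
    by (auto simp: F'_def)
  ultimately show "integral\<^sup>L (lebesgue_on G) f' = 0"
    using F'm by (simp add: integral_completion)
  show "integrable (lebesgue_on G) f'"
    using G F'i F'm \<open>(\<lambda>x. indicator G x *\<^sub>R f' x) = F'\<close>
    by (subst integrable_restrict_space) (auto simp: integrable_completion)
qed

text \<open>Translating the slab in the direction \<open>e\<close> by multiples of \<open>\<epsilon> / \<delta>\<close> gives about
  \<open>r \<delta> / \<epsilon>\<close> disjoint copies of it inside the ball of radius \<open>2 r\<close>.\<close>

lemma measure_slab_le:
  fixes a \<delta> \<epsilon> r :: real and \<rho> :: "'a::euclidean_space \<Rightarrow> real" and \<rho>' :: "'a \<Rightarrow> 'a \<Rightarrow> real"
  assumes der: "\<And>x. x \<in> ball p (2 * r) \<Longrightarrow> (\<rho> has_derivative \<rho>' x) (at x)"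
    and slope: "\<And>x. x \<in> ball p (2 * r) \<Longrightarrow> \<rho>' x e \<ge> \<delta>"
    and e: "norm e = 1" and \<delta>: "\<delta> > 0" and \<epsilon>: "\<epsilon> > 0" and r: "r > 0"
  defines "S \<equiv> {x \<in> ball p r. a < \<rho> x \<and> \<rho> x < a + \<epsilon>}"
  shows "S \<in> sets borel"
    and "measure lborel S \<le> \<epsilon> * (measure lborel (ball p (2 * r)) / (r * \<delta>))"
proof -
  have cont: "continuous_on (ball p r) \<rho>"
    by (rule has_derivative_continuous_on[where f' = \<rho>'])
      (use der r in \<open>auto intro: has_derivative_at_withinI\<close>)
  have "open (ball p r \<inter> \<rho> -` {a<..<a + \<epsilon>})"
    by (rule continuous_open_preimage[OF cont]) auto
  moreover have "S = ball p r \<inter> \<rho> -` {a<..<a + \<epsilon>}" by (auto simp: S_def)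
  ultimately show S: "S \<in> sets borel" by simp
  \<comment> \<open>A shift by \<open>h\<close> along \<open>e\<close> raises \<open>\<rho>\<close>
    by at least \<open>h * \<delta> = \<epsilon>\<close>, the full width of the slab.\<close>
  define h where "h = \<epsilon> / \<delta>"
  have h: "h > 0" using \<epsilon> \<delta> by (simp add: h_def)
  \<comment> \<open>The shifts \<open>0..N\<close> have length at most \<open>r\<close>, so the
    copies stay in the ball of radius \<open>2 * r\<close>. There are \<open>N + 1\<close> of them,
    which is at least \<open>r / h\<close> although \<open>N\<close> is rounded down.\<close>
  define N where "N = nat \<lfloor>r / h\<rfloor>"
  have N: "real N \<le> r / h" "r / h \<le> real (Suc N)"
    using r h by (auto simp: N_def) linarith+
  define Tr where "Tr j = (\<lambda>x. real j *\<^sub>R h *\<^sub>R e + x) ` S" for j :: nat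
  have Tm: "Tr j \<in> sets lborel" "emeasure lborel (Tr j) = emeasure lborel S" for j
  proof -
    define v where "v = - (real j *\<^sub>R h *\<^sub>R e)"
    have eq: "Tr j = (\<lambda>x. v + x) -` S" by (force simp: Tr_def v_def)
    have "(\<lambda>x. v + x) -` S \<inter> space lborel \<in> sets lborel"
      by (rule measurable_sets[OF _ S]) simp
    then show "Tr j \<in> sets lborel"
      unfolding eq by (simp only: space_lborel space_borel Int_UNIV_right)
    have "emeasure lborel S = emeasure (distr lborel borel (\<lambda>x. v + x)) S"
      by (simp only: lborel_distr_plus)
    also have "\<dots> = emeasure lborel (Tr j)"
      using S by (subst emeasure_distr) (auto simp: eq)
    finally show "emeasure lborel (Tr j) = emeasure lborel S" by simp
  qed
  have sub: "Tr j \<subseteq> ball p (2 * r)" if "j \<le> N" for j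
  proof
    fix y assume "y \<in> Tr j"
    then obtain x where x: "x \<in> S" "y = real j *\<^sub>R h *\<^sub>R e + x" by (auto simp: Tr_def)
    have "real j * h \<le> r"
      using that N(1) h by (simp add: pos_le_divide_eq)
        (meson mult_right_mono of_nat_mono order_trans less_imp_le)
    then have "norm (real j *\<^sub>R h *\<^sub>R e) \<le> r" using e h by simp
    moreover have "norm (x - p) < r" using x by (simp add: S_def dist_norm norm_minus_commute)
    ultimately have "norm (real j *\<^sub>R h *\<^sub>R e + (x - p)) < 2 * r"
      using norm_triangle_ineq[of "real j *\<^sub>R h *\<^sub>R e" "x - p"] by linarith
    then show "y \<in> ball p (2 * r)"
      using x by (simp add: dist_norm norm_minus_commute add_diff_eq)
  qed
  \<comment> \<open>With both endpoints in the convex ball, the whole segment lies where the slope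
    bound holds, and the mean value theorem applies.\<close>
  have grow: "\<rho> (x + s *\<^sub>R e) \<ge> \<rho> x + s * \<delta>"
    if x: "x \<in> ball p r" "x + s *\<^sub>R e \<in> ball p r" and s: "s > 0" for x s
  proof -
    have seg: "x + t *\<^sub>R e \<in> ball p (2 * r)" if "0 \<le> t" "t \<le> s" for t
    proof -
      have "x + t *\<^sub>R e = (1 - t / s) *\<^sub>R x + (t / s) *\<^sub>R (x + s *\<^sub>R e)"
        using s by (simp add: algebra_simps)
      also have "\<dots> \<in> ball p r"
        by (rule convexD_alt[OF convex_ball]) (use x that s in auto)
      finally show ?thesis using r by auto
    qed
    have "\<exists>z>0. z < s \<and> \<rho> (x + s *\<^sub>R e) - \<rho> (x + 0 *\<^sub>R e) = (s - 0) * \<rho>' (x + z *\<^sub>R e) e"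
    proof (rule MVT2[OF s])
      fix t assume t: "0 \<le> t" "t \<le> s"
      have "((\<lambda>t. \<rho> (x + t *\<^sub>R e)) has_derivative (\<lambda>u. \<rho>' (x + t *\<^sub>R e) (u *\<^sub>R e))) (at t)"
        by (rule has_derivative_compose[of "\<lambda>t. x + t *\<^sub>R e" "\<lambda>u. u *\<^sub>R e"])
          (auto intro!: derivative_eq_intros der seg t)
      moreover have "linear (\<rho>' (x + t *\<^sub>R e))"
        using der[OF seg[OF t]] has_derivative_linear by blast
      ultimately show "((\<lambda>t. \<rho> (x + t *\<^sub>R e)) has_real_derivative \<rho>' (x + t *\<^sub>R e) e) (at t)"
        by (simp add: has_field_derivative_def linear_cmul mult.commute[of _ "\<rho>' _ _"])
    qed
    then obtain z where z: "z > 0" "z < s" "\<rho> (x + s *\<^sub>R e) - \<rho> x = s * \<rho>' (x + z *\<^sub>R e) e" by auto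
    then have "s * \<delta> \<le> s * \<rho>' (x + z *\<^sub>R e) e"
      by (intro mult_left_mono slope seg) auto
    then show ?thesis using z by linarith
  qed
  \<comment> \<open>A common point of two copies would give two points of \<open>S\<close> differing
    by a positive multiple of \<open>h\<close> along \<open>e\<close>, hence values of
    \<open>\<rho>\<close> at least \<open>\<epsilon>\<close> apart, while \<open>S\<close> confines
    them to an open interval of length \<open>\<epsilon>\<close>.\<close>
  have disj_less: "Tr i \<inter> Tr j = {}" if "i < j" for i j
  proof (rule ccontr)
    assume "\<not> ?thesis"
    then obtain x y where xy: "x \<in> S" "y \<in> S" and "real i *\<^sub>R h *\<^sub>R e + x = real j *\<^sub>R h *\<^sub>R e + y"
      by (auto simp: Tr_def)
    then have x: "x = y + (real (j - i) * h) *\<^sub>R e"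
      using that by (simp add: of_nat_diff algebra_simps)
    have "\<rho> x \<ge> \<rho> y + real (j - i) * h * \<delta>"
      unfolding x using xy x h that by (intro grow) (auto simp: S_def)
    moreover have "real (j - i) * h * \<delta> \<ge> 1 * h * \<delta>"
      using that h \<delta> by (intro mult_right_mono) auto
    moreover have "h * \<delta> = \<epsilon>" using \<delta> by (simp add: h_def)
    ultimately show False using xy by (simp add: S_def)
  qed
  have disj: "disjoint_family_on Tr {..N}"
    unfolding disjoint_family_on_def
    by (metis disj_less inf_commute linorder_neqE_nat)
  have fin: "emeasure lborel (ball p (2 * r)) < \<infinity>" by (rule emeasure_lborel_ball_finite)
  have finS: "emeasure lborel (Tr j) \<noteq> \<infinity>" if "j \<le> N" for j
    using emeasure_mono[OF sub[OF that], of lborel] fin by auto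
  have "real (Suc N) * measure lborel S = (\<Sum>j\<le>N. measure lborel (Tr j))"
    using Tm by (simp add: measure_def)
  also have "\<dots> = measure lborel (\<Union>j\<le>N. Tr j)"
    using Tm finS disj by (intro measure_finite_Union[symmetric]) (auto simp: less_top[symmetric])
  also have "\<dots> \<le> measure lborel (ball p (2 * r))"
  proof (rule measure_mono_fmeasurable)
    show "ball p (2 * r) \<in> fmeasurable lborel" using fin by (auto simp: fmeasurable_def)
    show "(\<Union>j\<le>N. Tr j) \<subseteq> ball p (2 * r)" using sub by blast
    show "(\<Union>j\<le>N. Tr j) \<in> sets lborel" using Tm(1) by (intro sets.finite_UN) auto
  qed
  finally have "r / h * measure lborel S \<le> measure lborel (ball p (2 * r))"
    using mult_right_mono[OF N(2), of "measure lborel S"] by simp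
  then show "measure lborel S \<le> \<epsilon> * (measure lborel (ball p (2 * r)) / (r * \<delta>))"
    using r \<delta> \<epsilon> by (simp add: h_def field_simps)
qed

section \<open>The divergence theorem for tangential fields\<close>

lemma has_derivative_grad:
  fixes f :: "real^'m::finite \<Rightarrow> real"
  assumes "f differentiable (at x)"
  shows "(f has_derivative (\<lambda>h. grad f x \<bullet> h)) (at x)"
proof -
  let ?D = "frechet_derivative f (at x)"
  have D: "(f has_derivative ?D) (at x)" using assms frechet_derivative_works by blast
  have "?D h = grad f x \<bullet> h" for h
  proof -
    have "?D h = ?D (\<Sum>i\<in>UNIV. h $ i *\<^sub>R axis i 1)"
      by (simp add: basis_expansion flip: scalar_mult_eq_scaleR)
    also have "\<dots> = (\<Sum>i\<in>UNIV. h $ i *\<^sub>R ?D (axis i 1))"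
      using has_derivative_linear[OF D] by (simp add: linear_sum linear_scale)
    finally show ?thesis by (simp add: inner_vec_def grad_def partial_def mult.commute)
  qed
  then have "?D = (\<lambda>h. grad f x \<bullet> h)" by (rule ext)
  with D show ?thesis by simp
qed

lemma integrable_lebesgue_on_bounded:
  fixes f :: "'a::euclidean_space \<Rightarrow> 'b::euclidean_space"
  assumes "open S" "bounded S" "continuous_on S f" "bounded (f ` S)"
  shows "integrable (lebesgue_on S) f"
proof -
  obtain M where M: "\<And>x. x \<in> S \<Longrightarrow> norm (f x) \<le> M"
    using assms(4) by (auto simp: bounded_iff)
  interpret finite_measure "lebesgue_on S"
    using assms by (intro finite_measure_lebesgue_on bounded_set_imp_lmeasurable) auto
  show ?thesis
    by (rule integrable_const_bound[where B = M])
      (use assms M in \<open>auto intro!: continuous_imp_measurable_on_sets_lebesgue\<close>)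
qed

section \<open>Cut-off profiles with one continuous derivative\<close>

lemma has_real_derivative_max_0_squared:
  "((\<lambda>t::real. (max 0 t)\<^sup>2) has_real_derivative 2 * max 0 t) (at t)"
proof -
  consider "t < 0" | "t = 0" | "t > 0" by linarith
  then show ?thesis
  proof cases
    case 1
    have "((\<lambda>t::real. (max 0 t)\<^sup>2) has_real_derivative 0) (at t)"
      by (rule has_field_derivative_transform_within_open[where f = "\<lambda>_. 0" and S = "{..<0}"])
        (use 1 in auto)
    then show ?thesis using 1 by simp
  next
    case 2
    have "((\<lambda>h. (max 0 h)\<^sup>2 / h) \<longlongrightarrow> 0) (at (0::real))"
      by (rule Lim_null_comparison[where g = abs])
        (auto simp: power2_eq_square abs_mult max_def tendsto_rabs_zero)
    then show ?thesis using 2 by (simp add: DERIV_def)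
  next
    case 3
    have "((\<lambda>t::real. t\<^sup>2) has_real_derivative 2 * t) (at t)"
      by (auto intro!: derivative_eq_intros)
    then have "((\<lambda>t::real. (max 0 t)\<^sup>2) has_real_derivative 2 * t) (at t)"
      by (rule has_field_derivative_transform_within_open[where S = "{0<..}"]) (use 3 in auto)
    then show ?thesis using 3 by simp
  qed
qed

text \<open>To be evaluated at \<open>- \<rho> x / \<epsilon>\<close>: the cut-off then vanishes up
  to depth \<open>\<epsilon>\<close>, measured by \<open>- \<rho>\<close>, equals 1 beyond depth
  \<open>2 * \<epsilon>\<close>, and its derivative lives on the slab in between.\<close>

lemma smooth_step_exists:
  obtains \<phi> \<phi>' :: "real \<Rightarrow> real" where
    "\<And>s. (\<phi> has_real_derivative \<phi>' s) (at s)" "continuous_on UNIV \<phi>'"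
    "\<And>s. s \<le> 1 \<Longrightarrow> \<phi> s = 0" "\<And>s. s \<ge> 2 \<Longrightarrow> \<phi> s = 1"
    "\<And>s. s \<le> 1 \<or> s \<ge> 2 \<Longrightarrow> \<phi>' s = 0" "\<And>s. \<bar>\<phi> s\<bar> \<le> 1" "\<And>s. \<bar>\<phi>' s\<bar> \<le> 4"
proof
  define a where "a t = (max 0 t)\<^sup>2" for t :: real
  \<comment> \<open>Both corners are rounded by the same function \<open>a\<close>: the inner one
    starts the rise at 1 with zero slope, the outer one makes the function level off at 2, where
    \<open>a (s - 1)\<close> reaches 1.\<close>
  let ?\<phi> = "\<lambda>s::real. 1 - a (1 - a (s - 1))"
  let ?\<phi>' = "\<lambda>s::real. 4 * max 0 (1 - a (s - 1)) * max 0 (s - 1)"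
  have da: "(a has_real_derivative 2 * max 0 t) (at t)" for t
    unfolding a_def by (rule has_real_derivative_max_0_squared)
  have a: "a t \<ge> 0" "t \<le> 0 \<Longrightarrow> a t = 0" "t \<ge> 1 \<Longrightarrow> a t \<ge> 1" "t \<le> 1 \<Longrightarrow> a t \<le> 1" for t
    by (auto simp: a_def max_def power_le_one)
  show "(?\<phi> has_real_derivative ?\<phi>' s) (at s)" for s
    by (rule derivative_eq_intros DERIV_chain2[OF da] refl | simp)+
  show "continuous_on UNIV ?\<phi>'" unfolding a_def by (intro continuous_intros)
  show "?\<phi> s = 0" if "s \<le> 1" for s using that a(2)[of "s - 1"] by (simp add: a_def)
  show "?\<phi> s = 1" if "s \<ge> 2" for s using that a(3)[of "s - 1"] a(2) by simp
  show "?\<phi>' s = 0" if "s \<le> 1 \<or> s \<ge> 2" for s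
    using that a(3)[of "s - 1"] by (auto simp: max_def)
  show "\<bar>?\<phi> s\<bar> \<le> 1" for s using a(1)[of "1 - a (s - 1)"] a(4)[of "1 - a (s - 1)"] a(1)[of "s - 1"] by auto
  show "\<bar>?\<phi>' s\<bar> \<le> 4" for s
  proof (cases "s \<le> 2")
    case True
    have "max 0 (1 - a (s - 1)) * max 0 (s - 1) \<le> 1 * 1"
      using True a(1)[of "s - 1"] by (intro mult_mono) auto
    then show ?thesis by (simp add: abs_mult)
  next
    case False
    then show ?thesis using a(3)[of "s - 1"] by simp
  qed
qed

text \<open>Only the diagonal partial derivatives \<open>V' x $ i = \<partial>\<^sub>i V\<^sub>i\<close> enter, and only their sum has to
  be bounded: for \<open>V = v \<nabla>v\<close> the equation bounds the Laplacian of \<open>v\<close> up to the boundary, but not the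
  single second derivatives.\<close>

definition tangential_field ::
  "(real^'m::finite) set \<Rightarrow> (real^'m \<Rightarrow> real^'m) \<Rightarrow> (real^'m \<Rightarrow> real^'m) \<Rightarrow> bool" where
  "tangential_field \<Omega> V V' \<longleftrightarrow>
     continuous_on (closure \<Omega>) V \<and>
     (\<forall>x\<in>\<Omega>. \<forall>i. ((\<lambda>s. V (x + s *\<^sub>R axis i 1) $ i) has_real_derivative V' x $ i) (at 0)) \<and>
     continuous_on \<Omega> V' \<and> bounded ((\<lambda>x. \<Sum>i\<in>UNIV. V' x $ i) ` \<Omega>) \<and>
     (\<forall>p\<in>frontier \<Omega>. \<forall>n. outward_unit_normal \<Omega> p n \<longrightarrow> V p \<bullet> n = 0)"

section \<open>Derivatives along coordinate lines\<close>

lemma has_real_derivative_line: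
  fixes f :: "'a::real_inner \<Rightarrow> real"
  assumes "(f has_derivative (\<lambda>h. f' \<bullet> h)) (at x)"
  shows "((\<lambda>s. f (x + s *\<^sub>R e)) has_real_derivative f' \<bullet> e) (at 0)"
proof -
  have "((\<lambda>s. f (x + s *\<^sub>R e)) has_derivative (\<lambda>s. f' \<bullet> (s *\<^sub>R e))) (at 0)"
    by (rule has_derivative_compose[of "\<lambda>s. x + s *\<^sub>R e" "\<lambda>s. s *\<^sub>R e"])
      (use assms in \<open>auto intro!: derivative_eq_intros\<close>)
  then show ?thesis
    by (simp add: has_field_derivative_def mult.commute[of _ "f' \<bullet> e"])
qed

lemma has_real_derivative_line_cong:
  fixes f g :: "'a::real_normed_vector \<Rightarrow> real"
  assumes "((\<lambda>s. f (x + s *\<^sub>R e)) has_real_derivative f') (at 0)"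
    and "open G" "x \<in> G" "\<And>y. y \<in> G \<Longrightarrow> f y = g y"
  shows "((\<lambda>s. g (x + s *\<^sub>R e)) has_real_derivative f') (at 0)"
proof (rule has_field_derivative_transform_within_open[OF assms(1)])
  show "open ((\<lambda>s. x + s *\<^sub>R e) -` G)"
    by (intro open_vimage continuous_intros assms)
qed (use assms in auto)

lemma tangential_field_deriv_eq_0:
  assumes "tangential_field \<Omega> W W'" "open \<Omega>" "open G" "x \<in> \<Omega> \<inter> G"
    and "\<And>y. y \<in> \<Omega> \<inter> G \<Longrightarrow> W y = 0"
  shows "W' x = 0"
proof -
  have "W' x $ i = 0" for i
  proof (rule DERIV_unique)
    show "((\<lambda>s. W (x + s *\<^sub>R axis i 1) $ i) has_real_derivative W' x $ i) (at 0)"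
      using assms by (auto simp: tangential_field_def)
    show "((\<lambda>s. W (x + s *\<^sub>R axis i 1) $ i) has_real_derivative 0) (at 0)"
      by (rule has_real_derivative_line_cong[where f = "\<lambda>_. 0" and G = "\<Omega> \<inter> G"])
        (use assms in auto)
  qed
  then show ?thesis by (simp add: vec_eq_iff)
qed

lemma local_defining_function_D:
  assumes "local_defining_function 1 \<Omega> p U \<rho>"
  shows "open U" "p \<in> U" "continuous_on U \<rho>" "continuous_on U (grad \<rho>)"
    "\<And>x. x \<in> U \<Longrightarrow> (\<rho> has_derivative (\<lambda>h. grad \<rho> x \<bullet> h)) (at x)"
    "\<And>x. x \<in> U \<Longrightarrow> grad \<rho> x \<noteq> 0"
    "\<Omega> \<inter> U = {x \<in> U. \<rho> x < 0}" "frontier \<Omega> \<inter> U = {x \<in> U. \<rho> x = 0}"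
proof -
  note d = assms[unfolded local_defining_function_def]
  show U: "open U" "p \<in> U" and "\<And>x. x \<in> U \<Longrightarrow> grad \<rho> x \<noteq> 0"
    "\<Omega> \<inter> U = {x \<in> U. \<rho> x < 0}" "frontier \<Omega> \<inter> U = {x \<in> U. \<rho> x = 0}"
    using d by auto
  have Ck: "length js < 1 \<Longrightarrow> partials js \<rho> differentiable_on U"
    "length js \<le> 1 \<Longrightarrow> continuous_on U (partials js \<rho>)" for js
    using d by (auto simp: Ck_on_def)
  show "continuous_on U \<rho>" using Ck(2)[of "[]"] by simp
  have "continuous_on U (partial i \<rho>)" for i using Ck(2)[of "[i]"] by simp
  then show "continuous_on U (grad \<rho>)"
    unfolding grad_def by (intro continuous_intros)
  show "(\<rho> has_derivative (\<lambda>h. grad \<rho> x \<bullet> h)) (at x)" if "x \<in> U" for x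
    using Ck(1)[of "[]"] that U by (intro has_derivative_grad) (auto simp: differentiable_on_eq_differentiable_at)
qed

text \<open>The radius depends on the chart alone and serves all fields supported in the ball. This
  order of quantifiers lets compactness select finitely many balls before the localised fields are
  formed.\<close>

lemma integral_div_boundary_chart:
  fixes \<Omega> :: "(real^'m::finite) set"
  assumes \<Omega>: "open \<Omega>" "bounded \<Omega>" and ldf: "local_defining_function 1 \<Omega> p U \<rho>"
  obtains r where "r > 0"
    "\<And>W W'. tangential_field \<Omega> W W' \<Longrightarrow> (\<And>x. x \<in> closure \<Omega> - ball p r \<Longrightarrow> W x = 0) \<Longrightarrow>
       integral\<^sup>L (lebesgue_on \<Omega>) (\<lambda>x. \<Sum>i\<in>UNIV. W' x $ i) = 0"
proof -
  note U = local_defining_function_D[OF ldf]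
  define e where "e = grad \<rho> p /\<^sub>R norm (grad \<rho> p)"
  \<comment> \<open>Half the slope of \<open>\<rho>\<close> in the direction \<open>e\<close> at
    \<open>p\<close>; by continuity of the gradient the slope stays above it near
    \<open>p\<close>.\<close>
  define \<delta> where "\<delta> = norm (grad \<rho> p) / 2"
  have e1: "norm e = 1" and \<delta>: "\<delta> > 0" using U(6)[OF U(2)] by (auto simp: e_def \<delta>_def)
  have pe: "grad \<rho> p \<bullet> e > \<delta>"
    using U(6)[OF U(2)] by (simp add: e_def \<delta>_def dot_square_norm power2_eq_square field_simps)
  have "open (U \<inter> (\<lambda>x. grad \<rho> x \<bullet> e) -` {\<delta><..})"
    by (intro continuous_open_preimage continuous_intros U open_greaterThan)
  then obtain r2 where r2: "r2 > 0" "ball p r2 \<subseteq> U \<inter> (\<lambda>x. grad \<rho> x \<bullet> e) -` {\<delta><..}"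
    using U(2) pe by (elim openE[where x = p]) auto
  \<comment> \<open>Two halvings: the slab estimate on the ball of radius \<open>r1\<close> needs
    the slope bound on twice that radius, and supports of radius \<open>r < r1\<close> leave a
    margin, so that cutting \<open>\<Omega>\<close> down to \<open>R\<close> creates no new boundary
    contribution.\<close>
  define r1 where "r1 = r2 / 2"
  define r where "r = r1 / 2"
  have r: "r1 > 0" "r > 0" "r < r1" "2 * r1 = r2" using r2 by (auto simp: r_def r1_def)
  have slopes: "x \<in> U" "grad \<rho> x \<bullet> e \<ge> \<delta>" if "x \<in> ball p (2 * r1)" for x
    using r2 that unfolding r by auto
  define Kc where "Kc = measure lborel (ball p (2 * r1)) / (r1 * \<delta>)"
  define R where "R = ball p r1"
  have RU: "R \<subseteq> U" using slopes(1) r(1) by (auto simp: R_def)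
  define G where "G = \<Omega> \<inter> R"
  have G: "open G" "bounded G" using \<Omega> by (auto simp: G_def R_def)
  have G\<rho>: "\<rho> x < 0" if "x \<in> G" for x
    using that U(7) RU by (auto simp: G_def)
  define Q where "Q = cball p r \<inter> closure \<Omega>"
  have Q: "compact Q" "Q \<subseteq> U" "Q \<subseteq> R"
    using r RU \<Omega>(2) by (auto simp: Q_def R_def compact_closure intro!: compact_Int_closed)
  have cl: "closure \<Omega> = \<Omega> \<union> frontier \<Omega>"
    using \<Omega>(1) by (auto simp: frontier_def interior_open closure_subset[THEN subsetD])
  obtain \<phi> \<phi>' :: "real \<Rightarrow> real" where \<phi>:
    "\<And>s. (\<phi> has_real_derivative \<phi>' s) (at s)" "continuous_on UNIV \<phi>'"
    "\<And>s. s \<le> 1 \<Longrightarrow> \<phi> s = 0" "\<And>s. s \<ge> 2 \<Longrightarrow> \<phi> s = 1"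
    "\<And>s. s \<le> 1 \<or> s \<ge> 2 \<Longrightarrow> \<phi>' s = 0" "\<And>s. \<bar>\<phi> s\<bar> \<le> 1" "\<And>s. \<bar>\<phi>' s\<bar> \<le> 4"
    by (rule smooth_step_exists) blast
  have \<phi>c: "continuous_on UNIV \<phi>" using \<phi>(1) by (meson DERIV_continuous continuous_at_imp_continuous_on)
  have "integral\<^sup>L (lebesgue_on \<Omega>) (\<lambda>x. \<Sum>i\<in>UNIV. W' x $ i) = 0"
    if tf: "tangential_field \<Omega> W W'" and W0: "\<And>x. x \<in> closure \<Omega> - ball p r \<Longrightarrow> W x = 0" for W W'
  proof -
    have Wc: "continuous_on (closure \<Omega>) W" and W'c: "continuous_on \<Omega> W'"
      and Wd: "\<And>x i. x \<in> \<Omega> \<Longrightarrow> ((\<lambda>s. W (x + s *\<^sub>R axis i 1) $ i) has_real_derivative W' x $ i) (at 0)"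
      and Wb: "bounded ((\<lambda>x. \<Sum>i\<in>UNIV. W' x $ i) ` \<Omega>)"
      and Wn: "\<And>y n. y \<in> frontier \<Omega> \<Longrightarrow> outward_unit_normal \<Omega> y n \<Longrightarrow> W y \<bullet> n = 0"
      using tf by (auto simp: tangential_field_def)
    \<comment> \<open>The normal component of \<open>W\<close> up to the positive factor
      \<open>norm (grad \<rho> x)\<close>. It vanishes on the boundary inside \<open>U\<close>,
      because the same \<open>U\<close> and \<open>\<rho>\<close> form a local defining function at
      each boundary point there.\<close>
    define \<psi> where "\<psi> x = grad \<rho> x \<bullet> W x" for x
    define dv where "dv x = (\<Sum>i\<in>UNIV. W' x $ i)" for x
    have GQ: "W x = 0" if "x \<in> G - Q" for x
      using that W0[of x] closure_subset[of \<Omega>] by (auto simp: G_def Q_def)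
    have contQ: "continuous_on Q \<psi>" unfolding \<psi>_def
      by (intro continuous_intros continuous_on_subset[OF U(4)] continuous_on_subset[OF Wc] Q)
        (auto simp: Q_def)
    have contG: "continuous_on G \<psi>" unfolding \<psi>_def
      by (intro continuous_intros continuous_on_subset[OF U(4)] continuous_on_subset[OF Wc])
        (use RU closure_subset[of \<Omega>] in \<open>auto simp: G_def\<close>)
    have cdv: "continuous_on \<Omega> dv" unfolding dv_def by (intro continuous_intros W'c)
    have \<psi>0: "\<psi> y = 0" if "y \<in> frontier \<Omega> \<inter> U" for y
    proof -
      have "local_defining_function 1 \<Omega> y U \<rho>"
        using ldf that by (simp add: local_defining_function_def)
      then have "outward_unit_normal \<Omega> y (grad \<rho> y /\<^sub>R norm (grad \<rho> y))"
        unfolding outward_unit_normal_def by blast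
      then have "W y \<bullet> (grad \<rho> y /\<^sub>R norm (grad \<rho> y)) = 0" using Wn that by blast
      then show ?thesis using U(6)[of y] that by (simp add: \<psi>_def inner_commute)
    qed
    obtain B where B: "\<And>x. x \<in> \<Omega> \<Longrightarrow> \<bar>dv x\<bar> \<le> B"
      using Wb by (auto simp: bounded_iff dv_def)
    have \<phi>dv: "\<bar>\<phi> s * dv x\<bar> \<le> B" if "x \<in> \<Omega>" for s x
      using mult_mono[OF \<phi>(6)[of s] B[OF that]] by (simp add: abs_mult)
    obtain Bp where Bp: "\<And>x. x \<in> Q \<Longrightarrow> \<bar>\<psi> x\<bar> \<le> Bp"
      using compact_imp_bounded[OF compact_continuous_image[OF contQ Q(1)]] by (auto simp: bounded_iff)
    have BpG: "\<bar>\<psi> x\<bar> \<le> max 0 Bp" if "x \<in> G" for x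
      using Bp[of x] GQ[of x] that by (cases "x \<in> Q") (auto simp: \<psi>_def)
    have int1: "integrable (lebesgue_on G) (\<lambda>x. \<phi> (- \<rho> x / \<epsilon>) * dv x)" for \<epsilon>
    proof (rule integrable_lebesgue_on_bounded[OF G])
      show "continuous_on G (\<lambda>x. \<phi> (- \<rho> x / \<epsilon>) * dv x)"
        using RU by (cases "\<epsilon> = 0")
         (auto intro!: continuous_intros continuous_on_compose2[OF \<phi>c] continuous_on_subset[OF U(3)] continuous_on_subset[OF cdv] simp: G_def)
      show "bounded ((\<lambda>x. \<phi> (- \<rho> x / \<epsilon>) * dv x) ` G)"
        unfolding bounded_iff
        by (rule exI[of _ B]) (use \<phi>dv in \<open>auto simp: G_def\<close>)
    qed
    have int2: "integrable (lebesgue_on G) (\<lambda>x. \<phi>' (- \<rho> x / \<epsilon>) * \<psi> x)" for \<epsilon>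
    proof (rule integrable_lebesgue_on_bounded[OF G])
      show "continuous_on G (\<lambda>x. \<phi>' (- \<rho> x / \<epsilon>) * \<psi> x)"
        using RU by (cases "\<epsilon> = 0")
         (auto intro!: continuous_intros continuous_on_compose2[OF \<phi>(2)] continuous_on_subset[OF U(3)] contG[unfolded G_def] simp: G_def)
      show "bounded ((\<lambda>x. \<phi>' (- \<rho> x / \<epsilon>) * \<psi> x) ` G)"
        unfolding bounded_iff
        by (rule exI[of _ "4 * max 0 Bp"]) (use \<phi>(7) BpG in \<open>auto simp: abs_mult intro!: mult_mono\<close>)
    qed
    \<comment> \<open>The field \<open>\<phi> (- \<rho> x / \<epsilon>) *\<^sub>R W x\<close> has
      compact support in \<open>G\<close>, so its divergence integrates to 0. By the product rule
      that divergence is the left integrand minus the right integrand over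
      \<open>\<epsilon>\<close>.\<close>
    have key: "(\<integral>x. \<phi> (- \<rho> x / \<epsilon>) * dv x \<partial>lebesgue_on G) = (\<integral>x. \<phi>' (- \<rho> x / \<epsilon>) * \<psi> x \<partial>lebesgue_on G) / \<epsilon>"
      if \<epsilon>: "\<epsilon> > 0" for \<epsilon>
    proof -
      \<comment> \<open>The part of \<open>Q\<close> at depth at least \<open>\<epsilon>\<close>:
        compact, away from the boundary, and containing the support of the cut-off field.\<close>
      define K where "K = {x \<in> Q. \<rho> x \<in> {..- \<epsilon>}}"
      have K: "compact K"
      proof -
        have "closed (Q \<inter> \<rho> -` {..- \<epsilon>})"
          using Q compact_imp_closed by (intro continuous_closed_preimage continuous_on_subset[OF U(3)]) auto
        moreover have "K = Q \<inter> (Q \<inter> \<rho> -` {..- \<epsilon>})" by (auto simp: K_def)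
        ultimately show ?thesis using Q(1) by (metis compact_Int_closed)
      qed
      have KG: "K \<subseteq> G"
      proof
        fix x assume "x \<in> K"
        then have "x \<in> {x \<in> U. \<rho> x < 0}" "x \<in> R" using Q \<epsilon> by (auto simp: K_def)
        then show "x \<in> G" using U(7) by (auto simp: G_def)
      qed
      define f where "f i x = (if x \<in> G then \<phi> (- \<rho> x / \<epsilon>) * W x $ i else 0)" for i x
      define f' where "f' i x = \<phi>' (- \<rho> x / \<epsilon>) * (- grad \<rho> x $ i / \<epsilon>) * W x $ i + \<phi> (- \<rho> x / \<epsilon>) * W' x $ i" for i x
      have zero: "f i x = 0" if "x \<notin> K" for i x
      proof (cases "x \<in> Q \<and> x \<in> G")
        case True
        then have "- \<rho> x / \<epsilon> \<le> 1" using that \<epsilon> by (auto simp: K_def field_simps)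
        then show ?thesis by (simp add: f_def \<phi>(3))
      next
        case False
        then show ?thesis using GQ[of x] by (auto simp: f_def)
      qed
      have der: "((\<lambda>s. f i (x + s *\<^sub>R axis i 1)) has_real_derivative f' i x) (at 0)" if x: "x \<in> G" for i x
      proof (rule has_real_derivative_line_cong[where G = G and f = "\<lambda>x. \<phi> (- \<rho> x / \<epsilon>) * W x $ i"])
        have "((\<lambda>s. \<rho> (x + s *\<^sub>R axis i 1)) has_real_derivative grad \<rho> x $ i) (at 0)"
          using has_real_derivative_line[OF U(5), of x "axis i 1"] x RU by (auto simp: G_def inner_axis)
        then have 1: "((\<lambda>s. - \<rho> (x + s *\<^sub>R axis i 1) / \<epsilon>) has_real_derivative - grad \<rho> x $ i / \<epsilon>) (at 0)"
          using \<epsilon> by (auto intro!: derivative_eq_intros)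
        have 2: "((\<lambda>s. \<phi> (- \<rho> (x + s *\<^sub>R axis i 1) / \<epsilon>)) has_real_derivative
            \<phi>' (- \<rho> x / \<epsilon>) * (- grad \<rho> x $ i / \<epsilon>)) (at 0)"
          using DERIV_chain2[OF _ 1, of \<phi> "\<phi>' (- \<rho> x / \<epsilon>)"] \<phi>(1) by simp
        show "((\<lambda>s. \<phi> (- \<rho> (x + s *\<^sub>R axis i 1) / \<epsilon>) * W (x + s *\<^sub>R axis i 1) $ i) has_real_derivative f' i x) (at 0)"
          using DERIV_mult[OF 2 Wd[of x i]] x by (simp add: f'_def G_def algebra_simps)
      qed (use G x in \<open>auto simp: f_def\<close>)
      have \<rho>c: "continuous_on G \<rho>" and gc: "continuous_on G (grad \<rho>)"
        and WcG: "continuous_on G W" and W'cG: "continuous_on G W'"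
        using RU closure_subset[of \<Omega>]
        by (auto intro: continuous_on_subset[OF U(3)] continuous_on_subset[OF U(4)] continuous_on_subset[OF Wc]
            continuous_on_subset[OF W'c] simp: G_def)
      have fc: "continuous_on G (f i)" for i
      proof (rule continuous_on_eq)
        show "continuous_on G (\<lambda>x. \<phi> (- \<rho> x / \<epsilon>) * W x $ i)"
          using \<epsilon> by (intro continuous_intros continuous_on_compose2[OF \<phi>c] \<rho>c WcG) auto
      qed (simp add: f_def)
      have f'c: "continuous_on G (f' i)" for i
        unfolding f'_def using \<epsilon>
        by (intro continuous_intros continuous_on_compose2[OF \<phi>c] continuous_on_compose2[OF \<phi>(2)] \<rho>c WcG gc W'cG) auto
      note A = integral_directional_derivative_eq_0[OF K G(1) KG zero der fc f'c]
      have "(\<integral>x. (\<Sum>i\<in>UNIV. f' i x) \<partial>lebesgue_on G) = 0"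
        using A by (subst Bochner_Integration.integral_sum) auto
      moreover have "(\<Sum>i\<in>UNIV. f' i x) = \<phi> (- \<rho> x / \<epsilon>) * dv x - (\<phi>' (- \<rho> x / \<epsilon>) * \<psi> x) / \<epsilon>" for x
      proof -
        have "f' i x = \<phi> (- \<rho> x / \<epsilon>) * W' x $ i - \<phi>' (- \<rho> x / \<epsilon>) / \<epsilon> * (grad \<rho> x $ i * W x $ i)" for i
          by (simp add: f'_def)
        then show ?thesis
          by (simp add: dv_def \<psi>_def inner_vec_def sum_subtractf flip: sum_distrib_left sum_divide_distrib)
      qed
      ultimately show ?thesis
        using int1[of \<epsilon>] int2[of \<epsilon>] by simp
    qed
    define \<epsilon> where "\<epsilon> n = inverse (real (Suc n))" for n
    have \<epsilon>: "\<epsilon> n > 0" for n by (simp add: \<epsilon>_def)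
    have \<epsilon>0: "\<epsilon> \<longlonglongrightarrow> 0" unfolding \<epsilon>_def by (rule LIMSEQ_inverse_real_of_nat)
    interpret finite_measure "lebesgue_on G"
      using G by (intro finite_measure_lebesgue_on bounded_set_imp_lmeasurable) auto
    have lim1: "(\<lambda>n. \<integral>x. \<phi> (- \<rho> x / \<epsilon> n) * dv x \<partial>lebesgue_on G) \<longlonglongrightarrow> (\<integral>x. dv x \<partial>lebesgue_on G)"
    proof (rule integral_dominated_convergence[where w = "\<lambda>_. B"])
      show "dv \<in> borel_measurable (lebesgue_on G)"
        using G cdv by (intro continuous_imp_measurable_on_sets_lebesgue continuous_on_subset[OF cdv]) (auto simp: G_def)
      show "AE x in lebesgue_on G. (\<lambda>n. \<phi> (- \<rho> x / \<epsilon> n) * dv x) \<longlonglongrightarrow> dv x"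
      proof (rule AE_I2)
        fix x assume "x \<in> space (lebesgue_on G)"
        then have x: "\<rho> x < 0" using G\<rho> by auto
        have "eventually (\<lambda>n. \<epsilon> n < - \<rho> x / 2) sequentially"
          using \<epsilon>0 x by (intro order_tendstoD) auto
        then have "eventually (\<lambda>n. \<phi> (- \<rho> x / \<epsilon> n) * dv x = dv x) sequentially"
          by eventually_elim (use \<epsilon> in \<open>auto intro!: \<phi>(4) simp: pos_le_minus_divide_eq\<close>)
        then show "(\<lambda>n. \<phi> (- \<rho> x / \<epsilon> n) * dv x) \<longlonglongrightarrow> dv x" by (rule tendsto_eventually)
      qed
      show "AE x in lebesgue_on G. norm (\<phi> (- \<rho> x / \<epsilon> n) * dv x) \<le> B" for n
      proof (rule AE_I2)
        fix x assume "x \<in> space (lebesgue_on G)"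
        then show "norm (\<phi> (- \<rho> x / \<epsilon> n) * dv x) \<le> B" using \<phi>dv by (auto simp: G_def)
      qed
    qed (use int1 in auto)
    have lim2: "(\<lambda>n. (\<integral>x. \<phi>' (- \<rho> x / \<epsilon> n) * \<psi> x \<partial>lebesgue_on G) / \<epsilon> n) \<longlonglongrightarrow> 0"
    proof (rule LIMSEQ_I)
      fix t :: real assume t: "t > 0"
      have Kc0: "Kc \<ge> 0" using r \<delta> by (simp add: Kc_def)
      \<comment> \<open>Chosen for the final estimate: the bound 4 for \<open>\<phi>'\<close>, the
        bound \<open>\<tau>\<close> for \<open>\<psi>\<close> and the layer measure
        \<open>\<epsilon> n * Kc\<close> give \<open>4 * \<tau> * Kc\<close> after division by
        \<open>\<epsilon> n\<close>. The summand 1 keeps the denominator positive and the inequality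
        strict.\<close>
      define \<tau> where "\<tau> = t / (4 * Kc + 1)"
      have \<tau>: "\<tau> > 0" "4 * \<tau> * Kc < t"
        using t Kc0 by (auto simp: \<tau>_def field_simps add_pos_nonneg)
      \<comment> \<open>This set yields the uniform smallness of \<open>\<psi>\<close> near the
        boundary: it is compact and misses the boundary, so \<open>\<rho>\<close> stays below some
        \<open>- m\<close> on it, and a layer with \<open>2 * \<epsilon> n < m\<close> cannot meet
        it.\<close>
      define Z where "Z = {x \<in> Q. \<bar>\<psi> x\<bar> \<in> {\<tau>..}}"
      have Zc: "compact Z"
      proof -
        have "continuous_on Q (\<lambda>x. \<bar>\<psi> x\<bar>)" by (intro continuous_intros contQ)
        then have "closed (Q \<inter> (\<lambda>x. \<bar>\<psi> x\<bar>) -` {\<tau>..})"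
          using Q(1) compact_imp_closed by (intro continuous_closed_preimage) auto
        moreover have "Z = Q \<inter> (Q \<inter> (\<lambda>x. \<bar>\<psi> x\<bar>) -` {\<tau>..})" by (auto simp: Z_def)
        ultimately show ?thesis using Q(1) by (metis compact_Int_closed)
      qed
      have Zneg: "\<rho> x < 0" if "x \<in> Z" for x
      proof -
        have x: "x \<in> U" "x \<in> closure \<Omega>" "\<psi> x \<noteq> 0" using that Q \<tau> by (auto simp: Z_def Q_def)
        then have "x \<in> \<Omega>" using \<psi>0[of x] cl by auto
        then show ?thesis using x(1) U(7) by auto
      qed
      obtain m where m: "m > 0" "\<And>x. x \<in> Z \<Longrightarrow> \<rho> x \<le> - m"
      proof (cases "Z = {}")
        case True
        then show ?thesis using that[of 1] by auto
      next
        case False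
        have "continuous_on Z \<rho>" using Q by (intro continuous_on_subset[OF U(3)]) (auto simp: Z_def)
        then obtain z where "z \<in> Z" "\<And>x. x \<in> Z \<Longrightarrow> \<rho> x \<le> \<rho> z"
          using continuous_attains_sup[OF Zc False] by blast
        then show ?thesis using that[of "- \<rho> z"] Zneg by auto
      qed
      have "eventually (\<lambda>n. \<epsilon> n < m / 2) sequentially"
        using \<epsilon>0 m by (intro order_tendstoD) auto
      then obtain N where N: "\<And>n. n \<ge> N \<Longrightarrow> \<epsilon> n < m / 2" by (auto simp: eventually_sequentially)
      have "norm ((\<integral>x. \<phi>' (- \<rho> x / \<epsilon> n) * \<psi> x \<partial>lebesgue_on G) / \<epsilon> n - 0) < t" if n: "n \<ge> N" for n
      proof -
        \<comment> \<open>Exactly the region \<open>1 < - \<rho> x / \<epsilon> n < 2\<close>,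
          outside which \<open>\<phi>'\<close> vanishes.\<close>
        define S where "S = {x \<in> ball p r1. - 2 * \<epsilon> n < \<rho> x \<and> \<rho> x < - 2 * \<epsilon> n + \<epsilon> n}"
        have S: "S \<in> sets borel" "measure lborel S \<le> \<epsilon> n * Kc"
          unfolding S_def Kc_def
          by (rule measure_slab_le[where \<rho>' = "\<lambda>x h. grad \<rho> x \<bullet> h" and e = e];
              use slopes U(5) e1 \<delta> \<epsilon> r in auto)+
        have bound: "\<bar>\<phi>' (- \<rho> x / \<epsilon> n) * \<psi> x\<bar> \<le> 4 * \<tau> * indicator S x" if x: "x \<in> G" for x
        proof (cases "x \<in> S")
          case True
          have "\<bar>\<psi> x\<bar> \<le> \<tau>"
          proof (cases "x \<in> Q")
            case xQ: True
            have "x \<notin> Z" using m(2)[of x] N[OF n] True by (auto simp: S_def)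
            then show ?thesis using xQ by (auto simp: Z_def)
          next
            case False
            then show ?thesis using GQ x \<tau> by (simp add: \<psi>_def)
          qed
          then have "\<bar>\<phi>' (- \<rho> x / \<epsilon> n)\<bar> * \<bar>\<psi> x\<bar> \<le> 4 * \<tau>" by (intro mult_mono \<phi>(7)) auto
          then show ?thesis using True by (simp add: abs_mult)
        next
          case False
          then have "- \<rho> x / \<epsilon> n \<le> 1 \<or> - \<rho> x / \<epsilon> n \<ge> 2"
            using x \<epsilon>[of n] by (auto simp: S_def G_def R_def pos_le_divide_eq pos_le_minus_divide_eq pos_minus_divide_le_eq)
          then show ?thesis using \<phi>(5) False by simp
        qed
        have SG: "S \<inter> G \<in> sets borel" using S(1) G(1) by auto
        have SGr: "S \<inter> G \<in> sets (lebesgue_on G)"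
          using SG G(1) by (subst sets_restrict_space_iff) auto
        have iS: "integrable (lebesgue_on G) (\<lambda>x. 4 * \<tau> * indicator (S \<inter> G) x)"
          using SGr by (intro integrable_mult_right integrable_real_indicator)
            (auto simp: less_top[symmetric])
        have "\<bar>\<integral>x. \<phi>' (- \<rho> x / \<epsilon> n) * \<psi> x \<partial>lebesgue_on G\<bar> \<le> (\<integral>x. \<bar>\<phi>' (- \<rho> x / \<epsilon> n) * \<psi> x\<bar> \<partial>lebesgue_on G)"
          by (rule integral_abs_bound)
        also have "\<dots> \<le> (\<integral>x. 4 * \<tau> * indicator (S \<inter> G) x \<partial>lebesgue_on G)"
          using bound by (intro integral_mono integrable_abs int2 iS) (auto simp: indicator_def)
        also have "\<dots> = 4 * \<tau> * measure (lebesgue_on G) (S \<inter> G)"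
          by (simp add: Int_assoc)
        also have "measure (lebesgue_on G) (S \<inter> G) = measure lebesgue (S \<inter> G)"
          using G by (intro measure_restrict_space) auto
        also have "\<dots> = measure lborel (S \<inter> G)" using SG by (intro measure_completion) auto
        also have "\<dots> \<le> measure lborel S"
        proof (rule measure_mono_fmeasurable)
          show "S \<in> fmeasurable lborel"
          proof (rule fmeasurableI)
            have "emeasure lborel S \<le> emeasure lborel (ball p r1)"
              by (rule emeasure_mono) (auto simp: S_def)
            then show "emeasure lborel S < \<infinity>"
              using emeasure_lborel_ball_finite[of p r1] by (auto simp: less_top top_unique)
          qed (use S in auto)
        qed (use SG in auto)
        also have "\<dots> \<le> \<epsilon> n * Kc" by (rule S(2))
        finally have "\<bar>\<integral>x. \<phi>' (- \<rho> x / \<epsilon> n) * \<psi> x \<partial>lebesgue_on G\<bar> \<le> 4 * \<tau> * (\<epsilon> n * Kc)"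
          using \<tau> by simp
        then have "\<bar>\<integral>x. \<phi>' (- \<rho> x / \<epsilon> n) * \<psi> x \<partial>lebesgue_on G\<bar> / \<epsilon> n \<le> 4 * \<tau> * Kc"
          using \<epsilon>[of n] by (simp add: pos_divide_le_eq algebra_simps)
        then show ?thesis using \<tau>(2) \<epsilon>[of n] by simp
      qed
      then show "\<exists>N. \<forall>n\<ge>N. norm ((\<integral>x. \<phi>' (- \<rho> x / \<epsilon> n) * \<psi> x \<partial>lebesgue_on G) / \<epsilon> n - 0) < t"
        by blast
    qed
    \<comment> \<open>Points of \<open>\<Omega>\<close> outside \<open>R\<close> have a
      neighbourhood, the complement of \<open>cball p r\<close>, in which the field vanishes; its
      diagonal derivatives vanish there as well.\<close>
    have ind: "indicator \<Omega> x *\<^sub>R dv x = indicator G x *\<^sub>R dv x" for x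
    proof (cases "x \<in> \<Omega> - G")
      case True
      then have "W' x = 0"
        using W0 r closure_subset[of \<Omega>]
        by (intro tangential_field_deriv_eq_0[OF tf \<Omega>(1), of "- cball p r"])
          (auto simp: G_def R_def)
      then show ?thesis by (simp add: dv_def)
    next
      case False
      then show ?thesis by (auto simp: indicator_def G_def)
    qed
    have "(\<integral>x. dv x \<partial>lebesgue_on G) = 0"
      using LIMSEQ_unique[OF lim1] lim2 key[OF \<epsilon>] by simp
    moreover have "(\<integral>x. indicator \<Omega> x *\<^sub>R dv x \<partial>lebesgue) = (\<integral>x. indicator G x *\<^sub>R dv x \<partial>lebesgue)"
      by (simp only: ind)
    ultimately have "(\<integral>x. dv x \<partial>lebesgue_on \<Omega>) = 0"
      using \<Omega>(1) G(1) by (simp add: integral_restrict_space)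
    then show ?thesis by (simp add: dv_def)
  qed
  then show thesis using that[OF r(2)] by blast
qed

text \<open>No boundary layer arises here: each component, set to 0 outside \<open>\<Omega>\<close>,
  is supported in the compact ball, so translation invariance applies to it directly.\<close>

lemma integral_div_interior:
  fixes \<Omega> :: "(real^'m::finite) set"
  assumes \<Omega>: "open \<Omega>" and ball: "cball p r \<subseteq> \<Omega>"
    and tf: "tangential_field \<Omega> W W'" and W0: "\<And>x. x \<in> closure \<Omega> - ball p r \<Longrightarrow> W x = 0"
  shows "integral\<^sup>L (lebesgue_on \<Omega>) (\<lambda>x. \<Sum>i\<in>UNIV. W' x $ i) = 0"
proof -
  have tf': "continuous_on \<Omega> W" "continuous_on \<Omega> W'"
    "\<And>x i. x \<in> \<Omega> \<Longrightarrow> ((\<lambda>s. W (x + s *\<^sub>R axis i 1) $ i) has_real_derivative W' x $ i) (at 0)"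
    using tf closure_subset[of \<Omega>] by (auto simp: tangential_field_def elim: continuous_on_subset)
  define f where "f i x = (if x \<in> \<Omega> then W x $ i else 0)" for i x
  have "integral\<^sup>L (lebesgue_on \<Omega>) (\<lambda>x. W' x $ i) = 0" "integrable (lebesgue_on \<Omega>) (\<lambda>x. W' x $ i)" for i
  proof -
    have zero: "f i x = 0" if "x \<notin> cball p r" for x
      using W0[of x] that closure_subset[of \<Omega>] by (auto simp: f_def)
    have der: "((\<lambda>s. f i (x + s *\<^sub>R axis i 1)) has_real_derivative W' x $ i) (at 0)" if "x \<in> \<Omega>" for x
      by (rule has_real_derivative_line_cong[where f = "\<lambda>x. W x $ i" and G = \<Omega>])
        (use that tf' \<Omega> in \<open>auto simp: f_def\<close>)
    have "continuous_on \<Omega> (f i)"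
      by (rule continuous_on_eq[where f = "\<lambda>x. W x $ i"]) (auto simp: f_def intro!: continuous_intros tf')
    moreover have "continuous_on \<Omega> (\<lambda>x. W' x $ i)" by (intro continuous_intros tf')
    ultimately show "integral\<^sup>L (lebesgue_on \<Omega>) (\<lambda>x. W' x $ i) = 0" "integrable (lebesgue_on \<Omega>) (\<lambda>x. W' x $ i)"
      using integral_directional_derivative_eq_0[OF compact_cball \<Omega> ball zero der] by blast+
  qed
  then show ?thesis by (subst Bochner_Integration.integral_sum) auto
qed

text \<open>Localisation stays in the class because the divergence of the product is
  \<open>\<psi>' x \<bullet> V x\<close> plus \<open>\<psi> x\<close> times the whole divergence of
  \<open>V\<close>. A bound on the sum of the diagonal derivatives is therefore inherited without
  bounds on the single ones.\<close>

lemma tangential_field_scaleR: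
  fixes V V' :: "real^'m::finite \<Rightarrow> real^'m" and \<psi> :: "real^'m \<Rightarrow> real"
  assumes \<Omega>: "open \<Omega>" "bounded \<Omega>" and tf: "tangential_field \<Omega> V V'"
    and \<psi>: "\<And>x. x \<in> closure \<Omega> \<Longrightarrow> (\<psi> has_derivative (\<lambda>h. \<psi>' x \<bullet> h)) (at x)"
    and \<psi>': "continuous_on (closure \<Omega>) \<psi>'"
  shows "tangential_field \<Omega> (\<lambda>x. \<psi> x *\<^sub>R V x) (\<lambda>x. \<chi> i. \<psi>' x $ i * V x $ i + \<psi> x * V' x $ i)"
  unfolding tangential_field_def
proof (intro conjI ballI allI impI)
  have Vc: "continuous_on (closure \<Omega>) V" and V'c: "continuous_on \<Omega> V'"
    and Vd: "\<And>x i. x \<in> \<Omega> \<Longrightarrow> ((\<lambda>s. V (x + s *\<^sub>R axis i 1) $ i) has_real_derivative V' x $ i) (at 0)"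
    and Vb: "bounded ((\<lambda>x. \<Sum>i\<in>UNIV. V' x $ i) ` \<Omega>)"
    and Vn: "\<And>y n. y \<in> frontier \<Omega> \<Longrightarrow> outward_unit_normal \<Omega> y n \<Longrightarrow> V y \<bullet> n = 0"
    using tf by (auto simp: tangential_field_def)
  have sub: "\<Omega> \<subseteq> closure \<Omega>" by (rule closure_subset)
  have \<psi>c: "continuous_on (closure \<Omega>) \<psi>"
    by (meson \<psi> continuous_at_imp_continuous_on has_derivative_continuous)
  show "continuous_on (closure \<Omega>) (\<lambda>x. \<psi> x *\<^sub>R V x)" by (intro continuous_intros \<psi>c Vc)
  show "continuous_on \<Omega> (\<lambda>x. \<chi> i. \<psi>' x $ i * V x $ i + \<psi> x * V' x $ i)"
    using sub by (intro continuous_intros V'c continuous_on_subset[OF \<psi>'] continuous_on_subset[OF Vc] continuous_on_subset[OF \<psi>c])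
  show "(\<psi> p *\<^sub>R V p) \<bullet> n = 0" if "p \<in> frontier \<Omega>" "outward_unit_normal \<Omega> p n" for p n
    using Vn[OF that] by simp
  show "((\<lambda>s. (\<psi> (x + s *\<^sub>R axis i 1) *\<^sub>R V (x + s *\<^sub>R axis i 1)) $ i) has_real_derivative
      (\<chi> i. \<psi>' x $ i * V x $ i + \<psi> x * V' x $ i) $ i) (at 0)" if "x \<in> \<Omega>" for x i
  proof -
    have "((\<lambda>s. \<psi> (x + s *\<^sub>R axis i 1)) has_real_derivative \<psi>' x $ i) (at 0)"
      using has_real_derivative_line[OF \<psi>, of x "axis i 1"] that sub by (auto simp: inner_axis)
    from DERIV_mult[OF this Vd[OF that, of i]] show ?thesis
      by (simp add: algebra_simps)
  qed
  have cpt: "compact (closure \<Omega>)" using \<Omega> by (simp add: compact_closure)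
  have "bounded (\<psi> ` closure \<Omega>)" "bounded ((\<lambda>x. \<psi>' x \<bullet> V x) ` closure \<Omega>)"
    by (intro compact_imp_bounded compact_continuous_image cpt continuous_intros \<psi>c \<psi>' Vc)+
  with Vb obtain B1 B2 B3 where B: "\<And>x. x \<in> closure \<Omega> \<Longrightarrow> \<bar>\<psi> x\<bar> \<le> B1" "\<And>x. x \<in> closure \<Omega> \<Longrightarrow> \<bar>\<psi>' x \<bullet> V x\<bar> \<le> B2"
    "\<And>x. x \<in> \<Omega> \<Longrightarrow> \<bar>\<Sum>i\<in>UNIV. V' x $ i\<bar> \<le> B3"
    unfolding bounded_iff by auto metis
  have "\<bar>\<Sum>i\<in>UNIV. \<psi>' x $ i * V x $ i + \<psi> x * V' x $ i\<bar> \<le> B2 + B1 * B3" if "x \<in> \<Omega>" for x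
  proof -
    have x: "x \<in> closure \<Omega>" using that sub by auto
    have "(\<Sum>i\<in>UNIV. \<psi>' x $ i * V x $ i + \<psi> x * V' x $ i) = \<psi>' x \<bullet> V x + \<psi> x * (\<Sum>i\<in>UNIV. V' x $ i)"
      by (simp add: inner_vec_def sum.distrib sum_distrib_left)
    moreover have "\<bar>\<psi> x * (\<Sum>i\<in>UNIV. V' x $ i)\<bar> \<le> B1 * B3"
      unfolding abs_mult using B(1)[OF x] by (intro mult_mono B x that) auto
    ultimately show ?thesis using B(2)[OF x] by linarith
  qed
  then show "bounded ((\<lambda>x. \<Sum>i\<in>UNIV. (\<chi> i. \<psi>' x $ i * V x $ i + \<psi> x * V' x $ i) $ i) ` \<Omega>)"
    by (auto simp: bounded_iff)
qed

text \<open>Gluing by the partition of unity made of the bumps \<open>(r\<^sup>2 - |x - p|\<^sup>2)\<^sub>+\<^sup>2\<close>.\<close>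

theorem integral_div_tangential_field:
  fixes \<Omega> :: "(real^'m::finite) set"
  assumes dom: "bounded_Ck_domain 1 \<Omega>" and tf: "tangential_field \<Omega> V V'"
  shows "integral\<^sup>L (lebesgue_on \<Omega>) (\<lambda>x. \<Sum>i\<in>UNIV. V' x $ i) = 0"
proof -
  have \<Omega>: "open \<Omega>" "bounded \<Omega>" using dom by (auto simp: bounded_Ck_domain_def)
  have cl: "closure \<Omega> = \<Omega> \<union> frontier \<Omega>"
    using \<Omega>(1) by (auto simp: frontier_def interior_open closure_subset[THEN subsetD])
  have "\<forall>p\<in>closure \<Omega>. \<exists>r>0. \<forall>W W'. tangential_field \<Omega> W W' \<longrightarrow> (\<forall>x\<in>closure \<Omega> - ball p r. W x = 0) \<longrightarrow>
       integral\<^sup>L (lebesgue_on \<Omega>) (\<lambda>x. \<Sum>i\<in>UNIV. W' x $ i) = 0"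
  proof
    fix p assume "p \<in> closure \<Omega>"
    then consider "p \<in> \<Omega>" | "p \<in> frontier \<Omega>" using cl by auto
    then show "\<exists>r>0. \<forall>W W'. tangential_field \<Omega> W W' \<longrightarrow> (\<forall>x\<in>closure \<Omega> - ball p r. W x = 0) \<longrightarrow>
       integral\<^sup>L (lebesgue_on \<Omega>) (\<lambda>x. \<Sum>i\<in>UNIV. W' x $ i) = 0"
    proof cases
      case 1
      then obtain r where "r > 0" "cball p r \<subseteq> \<Omega>" using \<Omega>(1) open_contains_cball by blast
      then show ?thesis using integral_div_interior[OF \<Omega>(1)] by blast
    next
      case 2
      then obtain U \<rho> where "local_defining_function 1 \<Omega> p U \<rho>"
        using dom unfolding bounded_Ck_domain_def by blast
      from integral_div_boundary_chart[OF \<Omega> this] show ?thesis by (metis)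
    qed
  qed
  then obtain r where r: "\<And>p. p \<in> closure \<Omega> \<Longrightarrow> r p > 0"
    and loc: "\<And>p W W'. p \<in> closure \<Omega> \<Longrightarrow> tangential_field \<Omega> W W' \<Longrightarrow> (\<And>x. x \<in> closure \<Omega> - ball p (r p) \<Longrightarrow> W x = 0) \<Longrightarrow>
       integral\<^sup>L (lebesgue_on \<Omega>) (\<lambda>x. \<Sum>i\<in>UNIV. W' x $ i) = 0"
    by metis
  have "compact (closure \<Omega>)" using \<Omega> by (simp add: compact_closure)
  moreover have "closure \<Omega> \<subseteq> (\<Union>p\<in>closure \<Omega>. ball p (r p))" using r by force
  ultimately obtain P where P: "P \<subseteq> closure \<Omega>" "finite P" "closure \<Omega> \<subseteq> (\<Union>p\<in>P. ball p (r p))"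
    using compactE_image[of "closure \<Omega>" "closure \<Omega>" "\<lambda>p. ball p (r p)"] by (metis open_ball)
  define b where "b p x = (max 0 ((r p)\<^sup>2 - (x - p) \<bullet> (x - p)))\<^sup>2" for p x
  define b' where "b' p x = (- 4 * max 0 ((r p)\<^sup>2 - (x - p) \<bullet> (x - p))) *\<^sub>R (x - p)" for p x
  define S where "S x = (\<Sum>p\<in>P. b p x)" for x
  define S' where "S' x = (\<Sum>p\<in>P. b' p x)" for x
  have bd: "(b p has_derivative (\<lambda>h. b' p x \<bullet> h)) (at x)" for p x
  proof -
    have "((\<lambda>x. (r p)\<^sup>2 - (x - p) \<bullet> (x - p)) has_derivative (\<lambda>h. - 2 * ((x - p) \<bullet> h))) (at x)"
      by (auto intro!: derivative_eq_intros simp: inner_commute)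
    from has_derivative_compose[OF this has_real_derivative_max_0_squared[unfolded has_field_derivative_def]]
    show ?thesis unfolding b_def b'_def by (simp add: algebra_simps)
  qed
  have Sd: "(S has_derivative (\<lambda>h. S' x \<bullet> h)) (at x)" for x
    unfolding S_def S'_def inner_sum_left by (intro has_derivative_sum bd)
  have b0: "b p x \<ge> 0" for p x by (simp add: b_def)
  have S0: "S x > 0" if x: "x \<in> closure \<Omega>" for x
  proof -
    obtain p where p: "p \<in> P" "dist p x < r p" using subsetD[OF P(3) x] by auto
    then have "(x - p) \<bullet> (x - p) < (r p)\<^sup>2"
      by (simp add: dot_square_norm dist_norm norm_minus_commute power_strict_mono)
    then have "b p x > 0" by (simp add: b_def)
    then show ?thesis unfolding S_def using p P(2) b0 by (meson sum_pos2)
  qed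
  have bcont: "continuous_on X (b p)" "continuous_on X (b' p)" for p X
    unfolding b_def b'_def by (intro continuous_intros)+
  have Scont: "continuous_on X S" "continuous_on X S'" for X
    unfolding S_def S'_def by (intro continuous_intros bcont)+
  define \<zeta> where "\<zeta> p x = b p x / S x" for p x
  define \<zeta>' where "\<zeta>' p x = (b' p x - \<zeta> p x *\<^sub>R S' x) /\<^sub>R S x" for p x
  have \<zeta>d: "(\<zeta> p has_derivative (\<lambda>h. \<zeta>' p x \<bullet> h)) (at x)" if "x \<in> closure \<Omega>" for p x
    unfolding \<zeta>_def[abs_def]
    by (rule has_derivative_eq_rhs, rule has_derivative_divide'[OF bd Sd])
      (use S0[OF that] in \<open>auto simp: \<zeta>'_def \<zeta>_def field_simps inner_diff_left\<close>)
  have \<zeta>c: "continuous_on (closure \<Omega>) (\<zeta> p)" for p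
    unfolding \<zeta>_def[abs_def] using S0 by (intro continuous_intros bcont Scont) force
  have \<zeta>'c: "continuous_on (closure \<Omega>) (\<zeta>' p)" for p
    unfolding \<zeta>'_def[abs_def] using S0 by (intro continuous_intros bcont Scont \<zeta>c) force
  define W where "W p x = \<zeta> p x *\<^sub>R V x" for p x
  define W' where "W' p x = (\<chi> i. \<zeta>' p x $ i * V x $ i + \<zeta> p x * V' x $ i)" for p x
  have tfW: "tangential_field \<Omega> (W p) (W' p)" for p
    unfolding W_def[abs_def] W'_def[abs_def]
    by (rule tangential_field_scaleR[OF \<Omega> tf \<zeta>d \<zeta>'c])
  have int0: "integral\<^sup>L (lebesgue_on \<Omega>) (\<lambda>x. \<Sum>i\<in>UNIV. W' p x $ i) = 0" if "p \<in> P" for p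
  proof (rule loc[OF _ tfW])
    show "p \<in> closure \<Omega>" using that P by auto
    fix x assume x: "x \<in> closure \<Omega> - ball p (r p)"
    then have "(r p)\<^sup>2 \<le> (x - p) \<bullet> (x - p)"
      using r[OF \<open>p \<in> closure \<Omega>\<close>]
      by (auto simp: dot_square_norm dist_norm norm_minus_commute intro!: power_mono)
    then show "W p x = 0" by (simp add: W_def \<zeta>_def b_def)
  qed
  have intW: "integrable (lebesgue_on \<Omega>) (\<lambda>x. \<Sum>i\<in>UNIV. W' p x $ i)" for p
    by (rule integrable_lebesgue_on_bounded[OF \<Omega>])
      (use tfW[of p] in \<open>auto simp: tangential_field_def intro!: continuous_intros\<close>)
  \<comment> \<open>The extra terms of the product rule cancel: the functions
    \<open>\<zeta> p\<close> sum to 1 on \<open>\<Omega>\<close>, so their gradients sum to 0, which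
    is read off from the quotient formula for \<open>\<zeta>'\<close>.\<close>
  have "(\<Sum>i\<in>UNIV. V' x $ i) = (\<Sum>p\<in>P. \<Sum>i\<in>UNIV. W' p x $ i)" if x: "x \<in> \<Omega>" for x
  proof -
    have Sx: "S x > 0" using S0 x closure_subset by blast
    have s1: "(\<Sum>p\<in>P. \<zeta> p x) = 1"
      using Sx by (simp add: \<zeta>_def sum_divide_distrib[symmetric] S_def[symmetric])
    have "(\<Sum>p\<in>P. \<zeta>' p x) = (S' x - (\<Sum>p\<in>P. \<zeta> p x) *\<^sub>R S' x) /\<^sub>R S x"
      by (simp add: \<zeta>'_def S'_def sum_subtractf scaleR_sum_left flip: scaleR_sum_right)
    then have s2: "(\<Sum>p\<in>P. \<zeta>' p x) = 0" by (simp add: s1)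
    have "(\<Sum>p\<in>P. \<Sum>i\<in>UNIV. W' p x $ i) = (\<Sum>p\<in>P. \<zeta>' p x \<bullet> V x + \<zeta> p x * (\<Sum>i\<in>UNIV. V' x $ i))"
      by (simp add: W'_def inner_vec_def sum.distrib sum_distrib_left)
    also have "\<dots> = (\<Sum>p\<in>P. \<zeta>' p x) \<bullet> V x + (\<Sum>p\<in>P. \<zeta> p x) * (\<Sum>i\<in>UNIV. V' x $ i)"
      by (simp only: sum.distrib inner_sum_left sum_distrib_right)
    finally show ?thesis by (simp add: s1 s2)
  qed
  then have "integral\<^sup>L (lebesgue_on \<Omega>) (\<lambda>x. \<Sum>i\<in>UNIV. V' x $ i)
      = integral\<^sup>L (lebesgue_on \<Omega>) (\<lambda>x. \<Sum>p\<in>P. \<Sum>i\<in>UNIV. W' p x $ i)"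
    by (intro Bochner_Integration.integral_cong) auto
  also have "\<dots> = (\<Sum>p\<in>P. integral\<^sup>L (lebesgue_on \<Omega>) (\<lambda>x. \<Sum>i\<in>UNIV. W' p x $ i))"
    using intW by (intro Bochner_Integration.integral_sum) auto
  also have "\<dots> = 0" using int0 by simp
  finally show ?thesis .
qed

section \<open>A comparison principle\<close>

text \<open>Mean value theorem; since \<open>s \<ge> 1\<close>, the derivative of the power is
  nondecreasing and its value at \<open>M\<close> dominates.\<close>

lemma powr_diff_le:
  fixes y z s M :: real
  assumes "0 < z" "z \<le> y" "y \<le> M" "s \<ge> 1"
  shows "y powr s - z powr s \<le> s * M powr (s - 1) * (y - z)"
proof (cases "z = y")
  case False
  then have "z < y" using assms by simp
  then obtain x where x: "z < x" "x < y" "y powr s - z powr s = (y - z) * (s * x powr (s - 1))"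
    using MVT2[of z y "\<lambda>x. x powr s" "\<lambda>x. s * x powr (s - 1)"] assms
    by (force intro!: has_real_derivative_powr)
  moreover have "x powr (s - 1) \<le> M powr (s - 1)"
    using x assms by (intro powr_mono2) auto
  ultimately show ?thesis using assms by (simp add: mult.commute mult_left_mono)
qed simp

text \<open>The product of \<open>w\<close> with \<open>exp (- L * t)\<close> is nonincreasing, and
  the exponential factor does not affect signs. Derivatives are asked for only in the open interval,
  which lets the comparison start at time 0.\<close>

lemma gronwall_nonpos:
  fixes w w' :: "real \<Rightarrow> real"
  assumes ab: "a \<le> b" and cont: "continuous_on {a..b} w"
    and der: "\<And>t. a < t \<Longrightarrow> t < b \<Longrightarrow> (w has_real_derivative w' t) (at t)"
    and le: "\<And>t. a < t \<Longrightarrow> t < b \<Longrightarrow> w' t \<le> L * w t"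
    and init: "w a \<le> 0"
  shows "w b \<le> 0"
proof -
  let ?E = "\<lambda>t. w t * exp (- L * t)"
  have "?E b \<le> ?E a"
  proof (rule DERIV_nonpos_imp_decreasing_open[OF ab])
    fix t assume t: "a < t" "t < b"
    have "(?E has_real_derivative (w' t - L * w t) * exp (- L * t)) (at t)"
      by (auto intro!: derivative_eq_intros der t simp: algebra_simps)
    moreover have "(w' t - L * w t) * exp (- L * t) \<le> 0"
      using le[OF t] by (simp add: mult_le_0_iff)
    ultimately show "\<exists>y. (?E has_real_derivative y) (at t) \<and> y \<le> 0" by blast
  qed (intro continuous_intros cont)
  also have "?E a \<le> 0" using init by (simp add: mult_le_0_iff)
  finally show ?thesis by (simp add: mult_le_0_iff)
qed

text \<open>On a maximal interval where \<open>y > z\<close> the nonlinearity is Lipschitz, so Gronwall applies to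
  \<open>y - z\<close>.\<close>

lemma power_law_comparison:
  fixes y z y' z' a b :: "real \<Rightarrow> real" and s :: real
  assumes s: "s \<ge> 1"
    and cont: "continuous_on {0..} y" "continuous_on {0..} z" "continuous_on {0..} a" "continuous_on {0..} b"
    and zpos: "\<And>t. t \<ge> 0 \<Longrightarrow> z t > 0" and bnonneg: "\<And>t. t \<ge> 0 \<Longrightarrow> b t \<ge> 0"
    and dy: "\<And>t. t > 0 \<Longrightarrow> (y has_real_derivative y' t) (at t)"
    and dz: "\<And>t. t > 0 \<Longrightarrow> (z has_real_derivative z' t) (at t)"
    and sub: "\<And>t. t > 0 \<Longrightarrow> y' t \<le> a t * y t + b t * y t powr s"
    and super: "\<And>t. t > 0 \<Longrightarrow> z' t \<ge> a t * z t + b t * z t powr s"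
    and init: "y 0 \<le> z 0" and T: "T \<ge> 0"
  shows "y T \<le> z T"
proof (rule ccontr)
  assume neg: "\<not> y T \<le> z T"
  define w where "w t = y t - z t" for t
  have wc: "continuous_on {0..T} w"
    unfolding w_def by (intro continuous_intros continuous_on_subset[OF cont(1)] continuous_on_subset[OF cont(2)]) auto
  define Z where "Z = {0..T} \<inter> w -` {..0}"
  have Z: "compact Z"
    unfolding Z_def
    by (metis compact_Icc compact_Int_closed continuous_closed_preimage closed_atMost closed_atLeastAtMost inf_left_idem wc)
  have "0 \<in> Z" using init T by (auto simp: Z_def w_def)
  \<comment> \<open>The last time up to \<open>T\<close> at which \<open>y \<le> z\<close>; from
    there to \<open>T\<close> the difference \<open>w\<close> is positive.\<close>
  then obtain t0 where t0: "t0 \<in> Z" "\<And>t. t \<in> Z \<Longrightarrow> t \<le> t0"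
    using compact_attains_sup[OF Z] by blast
  have t0T: "0 \<le> t0" "t0 \<le> T" "w t0 \<le> 0" using t0(1) by (auto simp: Z_def)
  have wpos: "w t > 0" if "t0 < t" "t \<le> T" for t
    using t0(2)[of t] that t0T by (force simp: Z_def)
  have bdd: "\<exists>M. \<forall>t\<in>{0..T}. \<bar>f t\<bar> \<le> M" if "continuous_on {0..} f" for f :: "real \<Rightarrow> real"
  proof -
    have "bounded (f ` {0..T})"
      by (intro compact_imp_bounded compact_continuous_image continuous_on_subset[OF that]) auto
    then show ?thesis by (auto simp: bounded_iff)
  qed
  obtain My where My: "\<And>t. t \<in> {0..T} \<Longrightarrow> \<bar>y t\<bar> \<le> My" using bdd[OF cont(1)] by blast
  obtain Ma where Ma: "\<And>t. t \<in> {0..T} \<Longrightarrow> \<bar>a t\<bar> \<le> Ma" using bdd[OF cont(3)] by blast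
  obtain Mb where Mb: "\<And>t. t \<in> {0..T} \<Longrightarrow> \<bar>b t\<bar> \<le> Mb" using bdd[OF cont(4)] by blast
  \<comment> \<open>After \<open>t0\<close> one has \<open>0 < z < y \<le> My\<close>, so the
    Lipschitz constant of the power may be taken at \<open>My\<close>. The coefficients are bounded
    on \<open>{0..T}\<close> by compactness.\<close>
  define L where "L = Ma + Mb * (s * My powr (s - 1))"
  have "w T \<le> 0"
  proof (rule gronwall_nonpos[OF t0T(2), where w = w and w' = "\<lambda>t. y' t - z' t" and L = L])
    show "continuous_on {t0..T} w" using t0T by (intro continuous_on_subset[OF wc]) auto
    fix t assume t: "t0 < t" "t < T"
    then have t': "t > 0" "t \<in> {0..T}" using t0T by auto
    show "(w has_real_derivative y' t - z' t) (at t)"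
      unfolding w_def by (intro derivative_intros dy dz t')
    have w: "w t > 0" using wpos t by simp
    have "y' t - z' t \<le> a t * w t + b t * (y t powr s - z t powr s)"
      using sub[OF t'(1)] super[OF t'(1)] by (simp add: w_def algebra_simps)
    also have "\<dots> \<le> Ma * w t + Mb * (s * My powr (s - 1) * w t)"
    proof (intro add_mono mult_mono)
      show "a t \<le> Ma" and "b t \<le> Mb" using Ma[OF t'(2)] Mb[OF t'(2)] by auto
      show "0 \<le> Ma" "0 \<le> Mb" using Ma[OF t'(2)] Mb[OF t'(2)] by linarith+
      show "y t powr s - z t powr s \<le> s * My powr (s - 1) * w t"
        using powr_diff_le[of "z t" "y t" My s] zpos[of t] w My[OF t'(2)] t' s by (auto simp: w_def)
      show "0 \<le> y t powr s - z t powr s"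
        using zpos[of t] w t' s by (auto simp: w_def intro!: powr_mono2)
    qed (use w in auto)
    finally show "y' t - z' t \<le> L * w t" by (simp add: L_def algebra_simps)
  qed (use t0T in auto)
  then show False using neg by (simp add: w_def)
qed

section \<open>Energy estimates\<close>

text \<open>Along \<open>- n\<close> the defining function starts at 0 with slope
  \<open>- norm (grad \<rho> p)\<close>, so it is negative for small steps. This makes inward
  segments available to the mean value theorem.\<close>

lemma outward_unit_normal_inward:
  assumes "outward_unit_normal \<Omega> p n" "p \<in> frontier \<Omega>"
  obtains d where "d > 0" "\<And>h. 0 < h \<Longrightarrow> h < d \<Longrightarrow> p - h *\<^sub>R n \<in> \<Omega>"
proof -
  obtain U \<rho> where ldf: "local_defining_function 1 \<Omega> p U \<rho>" and n: "n = grad \<rho> p /\<^sub>R norm (grad \<rho> p)"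
    using assms(1) unfolding outward_unit_normal_def by blast
  note U = local_defining_function_D[OF ldf]
  have n1: "norm n = 1" and gn: "grad \<rho> p \<bullet> n > 0" using U(6)[OF U(2)] by (auto simp: n dot_square_norm)
  have "\<rho> p = 0" using U(2,8) assms(2) by auto
  obtain e where e: "e > 0" "ball p e \<subseteq> U" using U(1,2) openE by blast
  have "((\<lambda>s. \<rho> (p + s *\<^sub>R (- n))) has_real_derivative - (grad \<rho> p \<bullet> n)) (at 0)"
    using has_real_derivative_line[OF U(5)[OF U(2)], of "- n"] by simp
  then obtain d where d: "d > 0" "\<And>h. h > 0 \<Longrightarrow> h < d \<Longrightarrow> \<rho> p > \<rho> (p + h *\<^sub>R (- n))"
    using DERIV_neg_dec_right[of "\<lambda>s. \<rho> (p + s *\<^sub>R (- n))" _ 0] gn by force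
  show thesis
  proof (rule that[of "min d e"])
    fix h :: real assume h: "0 < h" "h < min d e"
    have "p - h *\<^sub>R n \<in> U" using e(2) h n1 by (intro subsetD[OF e(2)]) (simp add: dist_norm)
    moreover have "\<rho> (p - h *\<^sub>R n) < 0" using d(2)[of h] h \<open>\<rho> p = 0\<close> by simp
    ultimately show "p - h *\<^sub>R n \<in> \<Omega>" using U(7) by auto
  qed (use d e in auto)
qed

text \<open>Links the one-sided quotient in the boundary condition to the continuous extension
  \<open>G\<close> of the gradient. On an inward segment the quotient equals
  \<open>G \<bullet> n\<close> at an intermediate point, and continuity of \<open>G\<close> up to
  \<open>p\<close> gives the limit; \<open>v\<close> is differentiated only at interior
  points.\<close>

lemma has_normal_derivative_eq:
  fixes v :: "real^'m::finite \<Rightarrow> real"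
  assumes p: "p \<in> frontier \<Omega>" and n: "outward_unit_normal \<Omega> p n"
    and vc: "continuous_on (closure \<Omega>) v" and Gc: "continuous_on (closure \<Omega>) G"
    and vd: "\<And>x. x \<in> \<Omega> \<Longrightarrow> (v has_derivative (\<lambda>h. G x \<bullet> h)) (at x)"
    and nd: "has_normal_derivative \<Omega> v p l"
  shows "G p \<bullet> n = l"
proof -
  let ?q = "\<lambda>h. (v p - v (p - h *\<^sub>R n)) /\<^sub>R h"
  obtain d where d: "d > 0" "\<And>h. 0 < h \<Longrightarrow> h < d \<Longrightarrow> p - h *\<^sub>R n \<in> \<Omega>"
    using outward_unit_normal_inward[OF n p] by blast
  have pc: "p \<in> closure \<Omega>" using p by (simp add: frontier_def)
  have n1: "norm n \<le> 1"
    using n by (cases "n = 0") (auto simp: outward_unit_normal_def)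
  have "(?q \<longlongrightarrow> G p \<bullet> n) (at_right 0)"
  proof (rule tendstoI)
    fix e :: real assume "e > 0"
    moreover have "continuous_on (closure \<Omega>) (\<lambda>x. G x \<bullet> n)" by (intro continuous_intros Gc)
    ultimately obtain \<delta> where \<delta>: "\<delta> > 0" "\<And>y. y \<in> closure \<Omega> \<Longrightarrow> dist y p < \<delta> \<Longrightarrow> dist (G y \<bullet> n) (G p \<bullet> n) < e"
      using pc unfolding continuous_on_iff by metis
    have "dist (?q h) (G p \<bullet> n) < e" if h: "0 < h" "h < min d \<delta>" for h
    proof -
      have "\<exists>z. 0 < z \<and> z < h \<and> v (p - h *\<^sub>R n) - v (p - 0 *\<^sub>R n) = (\<lambda>s. G (p - z *\<^sub>R n) \<bullet> (- s *\<^sub>R n)) (h - 0)"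
      proof (rule mvt[OF h(1)])
        have "p - s *\<^sub>R n \<in> closure \<Omega>" if "s \<in> {0..h}" for s
        proof (cases "s = 0")
          case False
          then show ?thesis using d(2)[of s] that h closure_subset by force
        qed (use pc in simp)
        then show "continuous_on {0..h} (\<lambda>s. v (p - s *\<^sub>R n))"
          by (intro continuous_on_compose2[OF vc] continuous_intros) auto
        show "((\<lambda>s. v (p - s *\<^sub>R n)) has_derivative (\<lambda>u. G (p - s *\<^sub>R n) \<bullet> (- u *\<^sub>R n))) (at s)"
          if "0 < s" "s < h" for s
        proof (rule has_derivative_compose[where f = "\<lambda>s. p - s *\<^sub>R n" and g = v])
          show "((\<lambda>s. p - s *\<^sub>R n) has_derivative (\<lambda>u. - u *\<^sub>R n)) (at s)"
            by (auto intro!: derivative_eq_intros)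
          show "(v has_derivative (\<lambda>u. G (p - s *\<^sub>R n) \<bullet> u)) (at (p - s *\<^sub>R n))"
            using that h by (intro vd d(2)) auto
        qed
      qed blast
      then obtain z where z: "0 < z" "z < h" "v p - v (p - h *\<^sub>R n) = h * (G (p - z *\<^sub>R n) \<bullet> n)"
        by auto
      have "?q h = G (p - z *\<^sub>R n) \<bullet> n" using z h by simp
      moreover have "dist (p - z *\<^sub>R n) p < \<delta>"
      proof -
        have "z * norm n \<le> z" using z by (intro mult_left_le n1) simp
        then have "z * norm n < \<delta>" using z h by linarith
        then show ?thesis using z by (simp add: dist_norm)
      qed
      moreover have "p - z *\<^sub>R n \<in> closure \<Omega>" using d(2)[of z] z h closure_subset by force
      ultimately show ?thesis using \<delta>(2) by simp
    qed
    then show "eventually (\<lambda>h. dist (?q h) (G p \<bullet> n) < e) (at_right 0)"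
      using d(1) \<delta>(1) by (auto simp: eventually_at_right_field intro!: exI[of _ "min d \<delta>"])
  qed
  moreover have "(?q \<longlongrightarrow> l) (at_right 0)" using nd n by (auto simp: has_normal_derivative_def)
  ultimately show ?thesis using tendsto_unique[OF trivial_limit_at_right_real] by blast
qed

lemma bounded_image_closure:
  fixes f :: "'a::euclidean_space \<Rightarrow> 'b::real_normed_vector"
  assumes "bounded \<Omega>" "continuous_on (closure \<Omega>) f"
  shows "bounded (f ` \<Omega>)"
  using assms closure_subset[of \<Omega>]
  by (meson bounded_subset compact_closure compact_continuous_image compact_imp_bounded image_mono)

text \<open>Green's identity as the divergence theorem for \<open>v x *\<^sub>R G x\<close>, where
  \<open>G\<close> is the gradient and \<open>H\<close> collects the pure second derivatives. The
  divergence is the square of the norm of \<open>G x\<close> plus \<open>v x\<close> times the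
  Laplacian, and the Neumann condition makes the field tangential.\<close>

lemma neumann_energy_nonpos:
  fixes v :: "real^'m::finite \<Rightarrow> real"
  assumes dom: "bounded_Ck_domain 1 \<Omega>"
    and vc: "continuous_on (closure \<Omega>) v" and Gc: "continuous_on (closure \<Omega>) G"
    and vd: "\<And>x. x \<in> \<Omega> \<Longrightarrow> (v has_derivative (\<lambda>h. G x \<bullet> h)) (at x)"
    and Gd: "\<And>x i. x \<in> \<Omega> \<Longrightarrow> ((\<lambda>s. G (x + s *\<^sub>R axis i 1) $ i) has_real_derivative H x $ i) (at 0)"
    and Hc: "continuous_on \<Omega> H" and Hb: "bounded ((\<lambda>x. \<Sum>i\<in>UNIV. H x $ i) ` \<Omega>)"
    and nd: "\<And>p. p \<in> frontier \<Omega> \<Longrightarrow> has_normal_derivative \<Omega> v p 0"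
  shows "integrable (lebesgue_on \<Omega>) (\<lambda>x. v x * (\<Sum>i\<in>UNIV. H x $ i))"
    and "(\<integral>x. v x * (\<Sum>i\<in>UNIV. H x $ i) \<partial>lebesgue_on \<Omega>) \<le> 0"
proof -
  have \<Omega>: "open \<Omega>" "bounded \<Omega>" using dom by (auto simp: bounded_Ck_domain_def)
  have sub: "\<Omega> \<subseteq> closure \<Omega>" by (rule closure_subset)
  define lap where "lap x = (\<Sum>i\<in>UNIV. H x $ i)" for x
  define V where "V x = v x *\<^sub>R G x" for x
  define V' where "V' x = (\<chi> i. (G x $ i)\<^sup>2 + v x * H x $ i)" for x
  have sumV': "(\<Sum>i\<in>UNIV. V' x $ i) = (norm (G x))\<^sup>2 + v x * lap x" for x
    by (simp add: V'_def lap_def sum.distrib sum_distrib_left power2_norm_eq_inner inner_vec_def flip: power2_eq_square)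
  have bG: "bounded ((\<lambda>x. (norm (G x))\<^sup>2) ` \<Omega>)"
    by (intro bounded_image_closure \<Omega> continuous_intros Gc)
  have bl: "bounded ((\<lambda>x. v x * lap x) ` \<Omega>)"
  proof -
    obtain B1 B2 where B: "\<And>x. x \<in> \<Omega> \<Longrightarrow> \<bar>v x\<bar> \<le> B1" "\<And>x. x \<in> \<Omega> \<Longrightarrow> \<bar>lap x\<bar> \<le> B2"
      using Hb bounded_image_closure[OF \<Omega>(2) vc] by (auto simp: bounded_iff lap_def)
    have "\<bar>v x * lap x\<bar> \<le> B1 * B2" if "x \<in> \<Omega>" for x
      unfolding abs_mult using B(1)[OF that] by (intro mult_mono B that) auto
    then show ?thesis by (auto simp: bounded_iff)
  qed
  have vcl: "continuous_on \<Omega> (\<lambda>x. v x * lap x)"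
    unfolding lap_def by (intro continuous_intros Hc continuous_on_subset[OF vc sub])
  have Gcl: "continuous_on \<Omega> (\<lambda>x. (norm (G x))\<^sup>2)"
    by (intro continuous_intros continuous_on_subset[OF Gc sub])
  note int = integrable_lebesgue_on_bounded[OF \<Omega> vcl bl] integrable_lebesgue_on_bounded[OF \<Omega> Gcl bG]
  have "tangential_field \<Omega> V V'"
    unfolding tangential_field_def
  proof (intro conjI ballI allI impI)
    show "continuous_on (closure \<Omega>) V" unfolding V_def by (intro continuous_intros vc Gc)
    show "continuous_on \<Omega> V'" unfolding V'_def
      by (intro continuous_intros Hc continuous_on_subset[OF vc sub] continuous_on_subset[OF Gc sub])
    show "bounded ((\<lambda>x. \<Sum>i\<in>UNIV. V' x $ i) ` \<Omega>)"
      unfolding sumV' by (rule bounded_plus_comp[OF bG bl])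
    show "V p \<bullet> n = 0" if "p \<in> frontier \<Omega>" "outward_unit_normal \<Omega> p n" for p n
      using has_normal_derivative_eq[OF that vc Gc vd nd[OF that(1)]] by (simp add: V_def)
    show "((\<lambda>s. V (x + s *\<^sub>R axis i 1) $ i) has_real_derivative V' x $ i) (at 0)" if x: "x \<in> \<Omega>" for x i
    proof -
      have "((\<lambda>s. v (x + s *\<^sub>R axis i 1)) has_real_derivative G x $ i) (at 0)"
        using has_real_derivative_line[OF vd[OF x], of "axis i 1"] by (simp add: inner_axis)
      from DERIV_mult[OF this Gd[OF x, of i]] show ?thesis
        by (simp add: V_def V'_def power2_eq_square algebra_simps)
    qed
  qed
  then have "(\<integral>x. (norm (G x))\<^sup>2 + v x * lap x \<partial>lebesgue_on \<Omega>) = 0"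
    using integral_div_tangential_field[OF dom, of V V'] by (simp add: sumV')
  then have "(\<integral>x. v x * lap x \<partial>lebesgue_on \<Omega>) = - (\<integral>x. (norm (G x))\<^sup>2 \<partial>lebesgue_on \<Omega>)"
    using int by simp
  also have "\<dots> \<le> 0" by simp
  finally show "(\<integral>x. v x * (\<Sum>i\<in>UNIV. H x $ i) \<partial>lebesgue_on \<Omega>) \<le> 0" by (simp add: lap_def)
  show "integrable (lebesgue_on \<Omega>) (\<lambda>x. v x * (\<Sum>i\<in>UNIV. H x $ i))" using int(1) by (simp add: lap_def)
qed

section \<open>Integrals depending on time\<close>

text \<open>The mean value inequality bounds all difference quotients by \<open>B\<close>, and a
  constant is an admissible majorant on a finite measure space.\<close>

lemma (in finite_measure) has_real_derivative_integral:
  fixes f f' :: "real \<Rightarrow> 'a \<Rightarrow> real"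
  assumes t: "t \<in> {a<..<b}"
    and int: "\<And>s. s \<in> {a<..<b} \<Longrightarrow> integrable M (f s)"
    and der: "\<And>s x. s \<in> {a<..<b} \<Longrightarrow> x \<in> space M \<Longrightarrow> ((\<lambda>s. f s x) has_real_derivative f' s x) (at s)"
    and bound: "\<And>s x. s \<in> {a<..<b} \<Longrightarrow> x \<in> space M \<Longrightarrow> \<bar>f' s x\<bar> \<le> B"
    and meas: "f' t \<in> borel_measurable M"
  shows "((\<lambda>s. integral\<^sup>L M (f s)) has_real_derivative integral\<^sup>L M (f' t)) (at t)"
proof -
  let ?Q = "\<lambda>h x. (f (t + h) x - f t x) / h"
  have "((\<lambda>h. (integral\<^sup>L M (f (t + h)) - integral\<^sup>L M (f t)) / h) \<longlongrightarrow> integral\<^sup>L M (f' t)) (at 0)"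
    unfolding tendsto_at_iff_sequentially comp_def
  proof (intro allI impI)
    fix X :: "nat \<Rightarrow> real" assume X0: "\<forall>i. X i \<in> UNIV - {0}" and X: "X \<longlonglongrightarrow> 0"
    have "eventually (\<lambda>n. t + X n \<in> {a<..<b}) sequentially"
      by (rule topological_tendstoD[OF tendsto_add[OF tendsto_const X]]) (use t in auto)
    then obtain N where N: "\<And>n. n \<ge> N \<Longrightarrow> t + X n \<in> {a<..<b}" by (auto simp: eventually_sequentially)
    \<comment> \<open>The domination holds only inside the time window, so the first
      \<open>N\<close> terms are dropped; the limit is carried back to \<open>X\<close> at the
      end.\<close>
    define Y where "Y n = X (n + N)" for n
    have Y: "Y \<longlonglongrightarrow> 0" "\<And>n. Y n \<noteq> 0" "\<And>n. t + Y n \<in> {a<..<b}"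
      using X0 N by (auto simp: Y_def[abs_def] intro!: LIMSEQ_ignore_initial_segment X)
    have lim: "(\<lambda>n. integral\<^sup>L M (?Q (Y n))) \<longlonglongrightarrow> integral\<^sup>L M (f' t)"
    proof (rule integral_dominated_convergence[where w = "\<lambda>_. B"])
      show "?Q (Y n) \<in> borel_measurable M" for n
        using int[OF t] int[OF Y(3)[of n]] by (intro borel_measurable_divide borel_measurable_diff) auto
      show "AE x in M. (\<lambda>n. ?Q (Y n) x) \<longlonglongrightarrow> f' t x"
      proof (rule AE_I2)
        fix x assume "x \<in> space M"
        then have "((\<lambda>h. ?Q h x) \<longlongrightarrow> f' t x) (at 0)"
          using der[OF t] by (simp add: DERIV_def)
        then show "(\<lambda>n. ?Q (Y n) x) \<longlonglongrightarrow> f' t x"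
          using Y(1,2) unfolding tendsto_at_iff_sequentially comp_def by simp
      qed
      show "AE x in M. norm (?Q (Y n) x) \<le> B" for n
      proof (rule AE_I2)
        fix x assume x: "x \<in> space M"
        have "norm (f (t + Y n) x - f t x) \<le> B * norm (t + Y n - t)"
        proof (rule field_differentiable_bound[where S = "{a<..<b}" and f = "\<lambda>s. f s x" and f' = "\<lambda>s. f' s x"])
          show "((\<lambda>s. f s x) has_field_derivative f' s x) (at s within {a<..<b})" if "s \<in> {a<..<b}" for s
            using der[OF that x] has_field_derivative_at_within by blast
        qed (use bound x t Y(3) in auto)
        then show "norm (?Q (Y n) x) \<le> B"
          using Y(2)[of n] by (simp add: pos_divide_le_eq)
      qed
    qed (use meas in auto)
    have "integral\<^sup>L M (?Q (Y n)) = (integral\<^sup>L M (f (t + Y n)) - integral\<^sup>L M (f t)) / Y n" for n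
      using int[OF t] int[OF Y(3)[of n]] by simp
    then have "(\<lambda>n. integral\<^sup>L M (?Q (Y n))) = (\<lambda>n. (integral\<^sup>L M (f (t + Y n)) - integral\<^sup>L M (f t)) / Y n)"
      by (rule ext)
    with lim have "(\<lambda>n. (integral\<^sup>L M (f (t + X (n + N))) - integral\<^sup>L M (f t)) / X (n + N)) \<longlonglongrightarrow> integral\<^sup>L M (f' t)"
      by (simp only: Y_def)
    then show "(\<lambda>n. (integral\<^sup>L M (f (t + X n)) - integral\<^sup>L M (f t)) / X n) \<longlonglongrightarrow> integral\<^sup>L M (f' t)"
      by (rule LIMSEQ_offset)
  qed
  then show ?thesis by (simp add: DERIV_def)
qed

text \<open>The point is continuity at time 0, where the solution concept provides no time
  derivative and the comparison nevertheless starts. On compact time intervals the integrand is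
  bounded by compactness of the closure.\<close>

lemma continuous_on_integral_lebesgue_on:
  fixes f :: "real \<Rightarrow> 'a::euclidean_space \<Rightarrow> real"
  assumes \<Omega>: "open \<Omega>" "bounded \<Omega>" and fc: "continuous_on ({0..} \<times> closure \<Omega>) (\<lambda>(t, x). f t x)"
  shows "continuous_on {0..} (\<lambda>t. integral\<^sup>L (lebesgue_on \<Omega>) (f t))"
  unfolding continuous_on_sequentially comp_def
proof (intro allI ballI impI, elim conjE)
  fix X :: "nat \<Rightarrow> real" and t :: real
  assume t: "t \<in> {0..}" and X0: "\<forall>n. X n \<in> {0..}" and X: "X \<longlonglongrightarrow> t"
  interpret finite_measure "lebesgue_on \<Omega>"
    using \<Omega> by (intro finite_measure_lebesgue_on bounded_set_imp_lmeasurable) auto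
  obtain T where T: "\<And>n. X n \<le> T"
    using Bseq_def X convergentI convergent_imp_Bseq by (metis abs_le_D1 real_norm_def)
  have "bounded ((\<lambda>(t, x). f t x) ` ({0..T} \<times> closure \<Omega>))"
    by (intro compact_imp_bounded compact_continuous_image compact_Times continuous_on_subset[OF fc])
      (use \<Omega> in \<open>auto simp: compact_closure\<close>)
  then obtain B where B: "\<And>s x. s \<in> {0..T} \<Longrightarrow> x \<in> closure \<Omega> \<Longrightarrow> \<bar>f s x\<bar> \<le> B"
    by (fastforce simp: bounded_iff)
  have sec: "continuous_on \<Omega> (f s)" if "s \<ge> 0" for s
    by (rule continuous_on_compose2[OF fc, of _ "\<lambda>x. (s, x)", simplified])
      (use that closure_subset[of \<Omega>] in \<open>auto intro!: continuous_intros\<close>)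
  show "(\<lambda>n. integral\<^sup>L (lebesgue_on \<Omega>) (f (X n))) \<longlonglongrightarrow> integral\<^sup>L (lebesgue_on \<Omega>) (f t)"
  proof (rule integral_dominated_convergence[where w = "\<lambda>_. B"])
    show "f t \<in> borel_measurable (lebesgue_on \<Omega>)" "f (X n) \<in> borel_measurable (lebesgue_on \<Omega>)" for n
      using sec t X0 \<Omega> by (auto intro!: continuous_imp_measurable_on_sets_lebesgue)
    show "AE x in lebesgue_on \<Omega>. (\<lambda>n. f (X n) x) \<longlonglongrightarrow> f t x"
    proof (rule AE_I2)
      fix x assume "x \<in> space (lebesgue_on \<Omega>)"
      then have "x \<in> closure \<Omega>" using closure_subset by auto
      then have "continuous_on {0..} (\<lambda>s. f s x)"
        by (intro continuous_on_compose2[OF fc, of _ "\<lambda>s. (s, x)", simplified])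
          (auto intro!: continuous_intros)
      then show "(\<lambda>n. f (X n) x) \<longlonglongrightarrow> f t x"
        using t X0 X unfolding continuous_on_sequentially comp_def by blast
    qed
    show "AE x in lebesgue_on \<Omega>. norm (f (X n) x) \<le> B" for n
      using B T X0 closure_subset[of \<Omega>] by (intro AE_I2) auto
  qed auto
qed

section \<open>Regularity read off from the solution concept\<close>

text \<open>The time derivative extends continuously to the closure for positive times, and
  \<open>0 < a\<close> keeps the time interval compact in that range. The bound serves twice: as a
  majorant under the integral and, through the equation, as a bound for the Laplacian.\<close>

lemma classical_neumann_solution_bounded_time_derivative:
  fixes u :: "real \<Rightarrow> real^'m::finite \<Rightarrow> real^'n::finite"
  assumes sol: "classical_neumann_solution \<Omega> D F u0 u" and "bounded \<Omega>" "0 < a"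
  shows "\<exists>M. \<forall>t\<in>{a..b}. \<forall>x\<in>\<Omega>. norm (vector_derivative (\<lambda>s. u s x) (at t)) \<le> M"
proof -
  obtain G where G: "continuous_on ({0<..} \<times> closure \<Omega>) G"
    "\<And>t x. t > 0 \<Longrightarrow> x \<in> \<Omega> \<Longrightarrow> G (t, x) = vector_derivative (\<lambda>s. u s x) (at t)"
    using sol unfolding classical_neumann_solution_def extends_continuously_def by fastforce
  have "bounded (G ` ({a..b} \<times> closure \<Omega>))"
    using assms(2,3)
    by (intro compact_imp_bounded compact_continuous_image compact_Times continuous_on_subset[OF G(1)])
      (auto simp: compact_closure)
  then obtain M where "\<And>z. z \<in> {a..b} \<times> closure \<Omega> \<Longrightarrow> norm (G z) \<le> M"
    by (auto simp: bounded_iff)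
  then have "norm (vector_derivative (\<lambda>s. u s x) (at t)) \<le> M" if "t \<in> {a..b}" "x \<in> \<Omega>" for t x
    using G(2)[of t x] that assms(3) closure_subset[of \<Omega>] by (metis (no_types, lifting) SigmaI atLeastAtMost_iff order_less_le_trans subsetD)
  then show ?thesis by blast
qed

lemma classical_neumann_solution_slice:
  fixes u :: "real \<Rightarrow> real^'m::finite \<Rightarrow> real^'n::finite"
  assumes sol: "classical_neumann_solution \<Omega> D F u0 u" and t: "t \<ge> 0"
  shows "continuous_on (closure \<Omega>) (u t)"
proof -
  have uc: "continuous_on ({0..} \<times> closure \<Omega>) (\<lambda>(t, x). u t x)"
    using sol by (simp add: classical_neumann_solution_def)
  show ?thesis
    by (rule continuous_on_compose2[OF uc, of _ "\<lambda>x. (t, x)", simplified])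
      (use t in \<open>auto intro!: continuous_intros\<close>)
qed

lemma classical_neumann_solution_time_derivative_continuous:
  fixes u :: "real \<Rightarrow> real^'m::finite \<Rightarrow> real^'n::finite"
  assumes sol: "classical_neumann_solution \<Omega> D F u0 u" and t: "t > 0"
  shows "continuous_on \<Omega> (\<lambda>x. vector_derivative (\<lambda>s. u s x) (at t))"
proof -
  obtain G where G: "continuous_on ({0<..} \<times> closure \<Omega>) G"
    "\<And>t x. t > 0 \<Longrightarrow> x \<in> \<Omega> \<Longrightarrow> G (t, x) = vector_derivative (\<lambda>s. u s x) (at t)"
    using sol unfolding classical_neumann_solution_def extends_continuously_def by fastforce
  have "continuous_on \<Omega> (\<lambda>x. G (t, x))"
    by (rule continuous_on_compose2[OF G(1)])
      (use t closure_subset[of \<Omega>] in \<open>auto intro!: continuous_intros\<close>)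
  then show ?thesis by (rule continuous_on_eq) (simp add: G(2) t)
qed

lemma norm_sq_has_real_derivative:
  fixes w :: "real \<Rightarrow> 'a::real_inner"
  assumes "w differentiable (at t)"
  shows "((\<lambda>s. (norm (w s))\<^sup>2) has_real_derivative 2 * (w t \<bullet> vector_derivative w (at t))) (at t)"
proof -
  have "(w has_derivative (\<lambda>h. h *\<^sub>R vector_derivative w (at t))) (at t)"
    using assms vector_derivative_works by (auto simp: has_vector_derivative_def)
  from has_derivative_inner[OF this this]
  have "((\<lambda>s. w s \<bullet> w s) has_derivative (\<lambda>h. 2 * (w t \<bullet> vector_derivative w (at t)) * h)) (at t)"
    by (rule has_derivative_eq_rhs) (auto simp: inner_commute)
  then show ?thesis by (simp add: power2_norm_eq_inner has_field_derivative_def)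
qed

lemma energy_derivative:
  fixes u :: "real \<Rightarrow> real^'m::finite \<Rightarrow> real^'n::finite"
  assumes sol: "classical_neumann_solution \<Omega> D F u0 u" and \<Omega>: "open \<Omega>" "bounded \<Omega>" and t: "t > 0"
  shows "((\<lambda>s. \<integral>x. (norm (u s x))\<^sup>2 \<partial>lebesgue_on \<Omega>) has_real_derivative
    (\<integral>x. 2 * (u t x \<bullet> vector_derivative (\<lambda>s. u s x) (at t)) \<partial>lebesgue_on \<Omega>)) (at t)"
proof -
  interpret finite_measure "lebesgue_on \<Omega>"
    using \<Omega> by (intro finite_measure_lebesgue_on bounded_set_imp_lmeasurable) auto
  let ?ut = "\<lambda>t x. vector_derivative (\<lambda>s. u s x) (at t)"
  \<comment> \<open>A window around \<open>t\<close> whose closure avoids time 0, where the time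
    derivative need not stay bounded.\<close>
  from classical_neumann_solution_bounded_time_derivative[OF sol \<Omega>(2) half_gt_zero[OF t], of "2 * t"]
  obtain M where "\<forall>s\<in>{t / 2..2 * t}. \<forall>x\<in>\<Omega>. norm (?ut s x) \<le> M" ..
  then have M: "norm (?ut s x) \<le> M" if "s \<in> {t / 2..2 * t}" "x \<in> \<Omega>" for s x
    using that by blast
  have uc: "continuous_on ({0..} \<times> closure \<Omega>) (\<lambda>(t, x). u t x)"
    using sol by (simp add: classical_neumann_solution_def)
  have "bounded ((\<lambda>(t, x). u t x) ` ({t / 2..2 * t} \<times> closure \<Omega>))"
    by (intro compact_imp_bounded compact_continuous_image compact_Times continuous_on_subset[OF uc])
      (use \<Omega> t in \<open>auto simp: compact_closure\<close>)
  then obtain N where N: "\<And>s x. s \<in> {t / 2..2 * t} \<Longrightarrow> x \<in> closure \<Omega> \<Longrightarrow> norm (u s x) \<le> N"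
    by (fastforce simp: bounded_iff)
  have sub: "\<Omega> \<subseteq> closure \<Omega>" by (rule closure_subset)
  show ?thesis
  proof (rule has_real_derivative_integral[where a = "t / 2" and b = "2 * t" and B = "2 * (N * M)"
        and f' = "\<lambda>s x. 2 * (u s x \<bullet> ?ut s x)"])
    show "integrable (lebesgue_on \<Omega>) (\<lambda>x. (norm (u s x))\<^sup>2)" if "s \<in> {t / 2<..<2 * t}" for s
    proof -
      have c: "continuous_on (closure \<Omega>) (\<lambda>x. (norm (u s x))\<^sup>2)"
        using that t by (intro continuous_intros classical_neumann_solution_slice[OF sol]) auto
      show ?thesis
        by (rule integrable_lebesgue_on_bounded[OF \<Omega> continuous_on_subset[OF c sub] bounded_image_closure[OF \<Omega>(2) c]])
    qed
    show "((\<lambda>s. (norm (u s x))\<^sup>2) has_real_derivative 2 * (u s x \<bullet> ?ut s x)) (at s)"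
      if "s \<in> {t / 2<..<2 * t}" "x \<in> space (lebesgue_on \<Omega>)" for s x
      using sol that t by (intro norm_sq_has_real_derivative) (auto simp: classical_neumann_solution_def)
    show "\<bar>2 * (u s x \<bullet> ?ut s x)\<bar> \<le> 2 * (N * M)"
      if "s \<in> {t / 2<..<2 * t}" "x \<in> space (lebesgue_on \<Omega>)" for s x
    proof -
      have "\<bar>u s x \<bullet> ?ut s x\<bar> \<le> norm (u s x) * norm (?ut s x)" by (rule Cauchy_Schwarz_ineq2)
      also have "\<dots> \<le> N * M"
      proof (rule mult_mono)
        show "norm (u s x) \<le> N" using N[of s x] that sub by auto
        then show "0 \<le> N" using norm_ge_zero order_trans by blast
      qed (use M that in auto)
      finally show ?thesis by simp
    qed
    show "(\<lambda>x. 2 * (u t x \<bullet> ?ut t x)) \<in> borel_measurable (lebesgue_on \<Omega>)"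
      using t \<Omega> sub
      by (intro continuous_imp_measurable_on_sets_lebesgue continuous_intros
          continuous_on_subset[OF classical_neumann_solution_slice[OF sol]]
          classical_neumann_solution_time_derivative_continuous[OF sol]) auto
  qed (use t in auto)
qed

lemma Ck_on_2_D:
  fixes f :: "real^'m::finite \<Rightarrow> 'b::real_normed_vector"
  assumes "Ck_on 2 S f"
  shows "f differentiable_on S" "partial i f differentiable_on S" "continuous_on S (partials [i, j] f)"
  using assms[unfolded Ck_on_def] by (force dest: spec[of _ "[]"] spec[of _ "[i]"] spec[of _ "[i, j]"])+

lemma has_derivative_partials:
  fixes f :: "real^'m::finite \<Rightarrow> real^'n::finite"
  assumes "f differentiable (at x)"
  shows "((\<lambda>y. f y $ j) has_derivative (\<lambda>h. (\<chi> i. partial i f x $ j) \<bullet> h)) (at x)"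
proof -
  have fD: "(f has_derivative frechet_derivative f (at x)) (at x)"
    using assms frechet_derivative_works by blast
  have D: "((\<lambda>y. f y $ j) has_derivative (\<lambda>h. frechet_derivative f (at x) h $ j)) (at x)"
    by (rule bounded_linear.has_derivative[OF bounded_linear_vec_nth fD])
  then have "(\<lambda>y. f y $ j) differentiable (at x)" by (rule differentiableI)
  moreover have "grad (\<lambda>y. f y $ j) x = (\<chi> i. partial i f x $ j)"
    by (simp add: grad_def partial_def frechet_derivative_at[OF D, symmetric])
  ultimately show ?thesis using has_derivative_grad by metis
qed

text \<open>A diagonal \<open>D t\<close> decouples the diffusion: each component is a scalar
  Neumann problem with nonpositive energy, and positive weights preserve the sign of the
  sum.\<close>

lemma diffusion_energy_nonpos:
  fixes u :: "real \<Rightarrow> real^'m::finite \<Rightarrow> real^'n::finite"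
  assumes sol: "classical_neumann_solution \<Omega> D F u0 u" and dom: "bounded_Ck_domain 1 \<Omega>" and t: "t > 0"
    and D_diag: "\<And>i j. i \<noteq> j \<Longrightarrow> D t $ i $ j = 0" and D_pos: "\<And>i. D t $ i $ i > 0"
    and F_bdd: "\<And>x. x \<in> \<Omega> \<Longrightarrow> norm (F (u t x) x t) \<le> M1"
  shows "integrable (lebesgue_on \<Omega>) (\<lambda>x. u t x \<bullet> (D t *v laplacian (u t) x))"
    and "(\<integral>x. u t x \<bullet> (D t *v laplacian (u t) x) \<partial>lebesgue_on \<Omega>) \<le> 0"
proof -
  have \<Omega>: "open \<Omega>" "bounded \<Omega>" using dom by (auto simp: bounded_Ck_domain_def)
  have Dv: "(D t *v w) $ j = D t $ j $ j * w $ j" for w :: "real^'n" and j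
  proof -
    have "(D t *v w) $ j = (\<Sum>k\<in>UNIV. D t $ j $ k * w $ k)"
      by (simp add: matrix_vector_mult_def)
    also have "\<dots> = (\<Sum>k\<in>{j}. D t $ j $ k * w $ k)"
      by (rule sum.mono_neutral_right) (auto simp: D_diag)
    finally show ?thesis by simp
  qed
  have Ck: "Ck_on 2 \<Omega> (u t)" using sol t by (simp add: classical_neumann_solution_def)
  have ext: "\<forall>i. \<exists>g. continuous_on ({0<..} \<times> closure \<Omega>) g \<and> (\<forall>z\<in>{0<..} \<times> \<Omega>. g z = (case z of (t, x) \<Rightarrow> partial i (u t) x))"
    using sol unfolding classical_neumann_solution_def extends_continuously_def by blast
  obtain P where P: "\<And>i. continuous_on ({0<..} \<times> closure \<Omega>) (P i)"
    "\<And>i x. x \<in> \<Omega> \<Longrightarrow> P i (t, x) = partial i (u t) x"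
  proof -
    from choice[OF ext] obtain P where P: "\<And>i. continuous_on ({0<..} \<times> closure \<Omega>) (P i)"
      "\<And>i z. z \<in> {0<..} \<times> \<Omega> \<Longrightarrow> P i z = (case z of (t, x) \<Rightarrow> partial i (u t) x)" by blast
    show thesis using P(2)[of "(t, _)"] t by (intro that[of P] P(1)) simp
  qed
  obtain M where M: "\<And>x. x \<in> \<Omega> \<Longrightarrow> norm (vector_derivative (\<lambda>s. u s x) (at t)) \<le> M"
    using classical_neumann_solution_bounded_time_derivative[OF sol \<Omega>(2) t, of t] by auto
  have eqn: "vector_derivative (\<lambda>s. u s x) (at t) = D t *v laplacian (u t) x + F (u t x) x t" if "x \<in> \<Omega>" for x
    using sol t that by (simp add: classical_neumann_solution_def)
  have comp: "integrable (lebesgue_on \<Omega>) (\<lambda>x. u t x $ j * laplacian (u t) x $ j) \<and>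
      (\<integral>x. u t x $ j * laplacian (u t) x $ j \<partial>lebesgue_on \<Omega>) \<le> 0" for j
  proof -
    define G where "G x = (\<chi> i. P i (t, x) $ j)" for x
    define H where "H x = (\<chi> i. partials [i, i] (u t) x $ j)" for x
    have lap: "laplacian (u t) x $ j = (\<Sum>i\<in>UNIV. H x $ i)" for x
      by (simp add: laplacian_def H_def)
    have vc: "continuous_on (closure \<Omega>) (\<lambda>x. u t x $ j)"
      using t by (intro continuous_intros classical_neumann_solution_slice[OF sol]) auto
    have Gc: "continuous_on (closure \<Omega>) G"
      unfolding G_def using t by (intro continuous_intros continuous_on_compose2[OF P(1)]) auto
    have vd: "((\<lambda>x. u t x $ j) has_derivative (\<lambda>h. G x \<bullet> h)) (at x)" if "x \<in> \<Omega>" for x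
      using has_derivative_partials[of "u t" x j] Ck_on_2_D(1)[OF Ck] \<Omega>(1) that P(2)[OF that]
      by (simp add: G_def differentiable_on_eq_differentiable_at)
    have Gd: "((\<lambda>s. G (x + s *\<^sub>R axis i 1) $ i) has_real_derivative H x $ i) (at 0)" if x: "x \<in> \<Omega>" for x i
    proof (rule has_real_derivative_line_cong[where f = "\<lambda>x. partial i (u t) x $ j" and G = \<Omega>])
      have "partial i (u t) differentiable (at x)"
        using Ck_on_2_D(2)[OF Ck] \<Omega>(1) x by (simp add: differentiable_on_eq_differentiable_at)
      from has_real_derivative_line[OF has_derivative_partials[OF this, of j], where e = "axis i 1"]
      show "((\<lambda>s. partial i (u t) (x + s *\<^sub>R axis i 1) $ j) has_real_derivative H x $ i) (at 0)"
        by (simp add: H_def inner_axis)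
    qed (use \<Omega> x P(2) in \<open>auto simp: G_def\<close>)
    have Hc: "continuous_on \<Omega> H"
      unfolding H_def by (intro continuous_intros Ck_on_2_D(3)[OF Ck])
    \<comment> \<open>Solving the equation for the Laplacian: it is the time derivative minus
      \<open>F\<close>, both bounded on \<open>\<Omega>\<close>, divided by the positive diagonal
      entry.\<close>
    have Hb: "bounded ((\<lambda>x. \<Sum>i\<in>UNIV. H x $ i) ` \<Omega>)"
    proof -
      have "\<bar>\<Sum>i\<in>UNIV. H x $ i\<bar> \<le> (M + M1) / D t $ j $ j" if x: "x \<in> \<Omega>" for x
      proof -
        have "D t $ j $ j * laplacian (u t) x $ j = (vector_derivative (\<lambda>s. u s x) (at t) - F (u t x) x t) $ j"
          by (simp add: eqn[OF x] Dv)
        then have "\<bar>D t $ j $ j * laplacian (u t) x $ j\<bar> \<le> norm (vector_derivative (\<lambda>s. u s x) (at t) - F (u t x) x t)"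
          using component_le_norm_cart by metis
        also have "\<dots> \<le> M + M1"
          using norm_triangle_ineq4[of "vector_derivative (\<lambda>s. u s x) (at t)" "F (u t x) x t"] M[OF x] F_bdd[OF x]
          by linarith
        finally show ?thesis using D_pos[of j] by (simp add: lap[symmetric] abs_mult pos_le_divide_eq mult.commute)
      qed
      then show ?thesis by (auto simp: bounded_iff)
    qed
    have nd: "has_normal_derivative \<Omega> (\<lambda>x. u t x $ j) p 0" if p: "p \<in> frontier \<Omega>" for p
    proof -
      have "has_normal_derivative \<Omega> (u t) p 0"
        using sol t p by (simp add: classical_neumann_solution_def)
      then show ?thesis unfolding has_normal_derivative_def
        by (auto dest!: tendsto_vec_nth[where i = j])
    qed
    show ?thesis
      unfolding lap using neumann_energy_nonpos[OF dom vc Gc vd Gd Hc Hb nd] by blast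
  qed
  have ip: "u t x \<bullet> (D t *v laplacian (u t) x) = (\<Sum>j\<in>UNIV. D t $ j $ j * (u t x $ j * laplacian (u t) x $ j))" for x
    by (simp add: inner_vec_def Dv algebra_simps)
  show "integrable (lebesgue_on \<Omega>) (\<lambda>x. u t x \<bullet> (D t *v laplacian (u t) x))"
    unfolding ip using comp by (intro Bochner_Integration.integrable_sum integrable_mult_right) auto
  have "(\<integral>x. u t x \<bullet> (D t *v laplacian (u t) x) \<partial>lebesgue_on \<Omega>) =
      (\<Sum>j\<in>UNIV. D t $ j $ j * (\<integral>x. u t x $ j * laplacian (u t) x $ j \<partial>lebesgue_on \<Omega>))"
    unfolding ip using comp by (subst Bochner_Integration.integral_sum) (auto intro!: integrable_mult_right)
  also have "\<dots> \<le> 0"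
    using comp D_pos by (intro sum_nonpos mult_nonneg_nonpos) (auto intro: less_imp_le)
  finally show "(\<integral>x. u t x \<bullet> (D t *v laplacian (u t) x) \<partial>lebesgue_on \<Omega>) \<le> 0" .
qed

lemma Ck_on_mono: "Ck_on k S f \<Longrightarrow> j \<le> k \<Longrightarrow> Ck_on j S f"
  by (auto simp: Ck_on_def)

lemma local_defining_function_mono:
  "local_defining_function k \<Omega> p U \<rho> \<Longrightarrow> j \<le> k \<Longrightarrow> local_defining_function j \<Omega> p U \<rho>"
  using Ck_on_mono by (auto simp: local_defining_function_def)

lemma bounded_Ck_domain_mono: "bounded_Ck_domain k \<Omega> \<Longrightarrow> j \<le> k \<Longrightarrow> bounded_Ck_domain j \<Omega>"
  unfolding bounded_Ck_domain_def by (blast intro: local_defining_function_mono)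

text \<open>Together with the integrability of the diffusion term this makes the reaction term
  integrable, through the equation.\<close>

lemma energy_density_derivative_integrable:
  fixes u :: "real \<Rightarrow> real^'m::finite \<Rightarrow> real^'n::finite"
  assumes sol: "classical_neumann_solution \<Omega> D F u0 u" and \<Omega>: "open \<Omega>" "bounded \<Omega>" and t: "t > 0"
  shows "integrable (lebesgue_on \<Omega>) (\<lambda>x. u t x \<bullet> vector_derivative (\<lambda>s. u s x) (at t))"
proof (rule integrable_lebesgue_on_bounded[OF \<Omega>])
  let ?ut = "\<lambda>x. vector_derivative (\<lambda>s. u s x) (at t)"
  have uc: "continuous_on (closure \<Omega>) (u t)"
    using t by (intro classical_neumann_solution_slice[OF sol]) simp
  show "continuous_on \<Omega> (\<lambda>x. u t x \<bullet> ?ut x)"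
    by (intro continuous_intros continuous_on_subset[OF uc closure_subset]
        classical_neumann_solution_time_derivative_continuous[OF sol t])
  obtain M where M: "\<And>x. x \<in> \<Omega> \<Longrightarrow> norm (?ut x) \<le> M"
    using classical_neumann_solution_bounded_time_derivative[OF sol \<Omega>(2) t, of t] by auto
  obtain N where N: "\<And>x. x \<in> \<Omega> \<Longrightarrow> norm (u t x) \<le> N"
    using bounded_image_closure[OF \<Omega>(2) uc] by (auto simp: bounded_iff)
  have "\<bar>u t x \<bullet> ?ut x\<bar> \<le> N * M" if x: "x \<in> \<Omega>" for x
  proof -
    have "\<bar>u t x \<bullet> ?ut x\<bar> \<le> norm (u t x) * norm (?ut x)" by (rule Cauchy_Schwarz_ineq2)
    also have "\<dots> \<le> N * M"
      using order_trans[OF norm_ge_zero N[OF x]] by (intro mult_mono M N x) auto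
    finally show ?thesis .
  qed
  then show "bounded ((\<lambda>x. u t x \<bullet> ?ut x) ` \<Omega>)" by (auto simp: bounded_iff)
qed

section \<open>The energy inequality and its comparison function\<close>

theorem theorem3p3:
  fixes \<Omega> :: "(real^'m::finite) set"
    and D :: "real \<Rightarrow> real^'n::finite^'n"
    and d :: "real \<Rightarrow> real"
    and A :: "real^'m \<Rightarrow> real \<Rightarrow> real^'n^'n"
    and B F :: "real^'n \<Rightarrow> real^'m \<Rightarrow> real \<Rightarrow> real^'n"
    and u0 :: "real^'m \<Rightarrow> real^'n"
    and u :: "real \<Rightarrow> real^'m \<Rightarrow> real^'n"
    and \<gamma> c0 C \<alpha> \<mu> g :: "real \<Rightarrow> real"
    and M1 cF p q c \<gamma>0 \<mu>0 \<mu>1 \<nu> k :: real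
  assumes dim: "CARD('m) \<le> 3"
    and dom: "bounded_Ck_domain 2 \<Omega>"
    and D_diag: "\<And>t i j. t \<ge> 0 \<Longrightarrow> i \<noteq> j \<Longrightarrow> D t $ i $ j = 0"
    and D_pos: "\<And>t i. t \<ge> 0 \<Longrightarrow> D t $ i $ i > 0"
    and d_pos: "\<And>t. t \<ge> 0 \<Longrightarrow> d t > 0"
    and D_ge: "\<And>t i. t \<ge> 0 \<Longrightarrow> D t $ i $ i \<ge> d t"
    and F_eq: "\<And>w x t. F w x t = A x t *v w + B w x t"
    and F_zero: "\<And>x t. x \<in> \<Omega> \<Longrightarrow> t \<ge> 0 \<Longrightarrow> F 0 x t = 0"
    and F_bdd: "\<And>w x t. t \<ge> 0 \<Longrightarrow> norm (F w x t) \<le> M1"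
    and cF_pos: "cF > 0"
    and F_lip: "\<And>v w x t s. x \<in> \<Omega> \<Longrightarrow> t \<ge> 0 \<Longrightarrow> s \<ge> 0 \<Longrightarrow>
        norm (F v x t - F w x s) \<le> cF * (\<bar>t - s\<bar> + norm (v - w))"
    and F_cont: "\<And>w t. t \<ge> 0 \<Longrightarrow> continuous_on \<Omega> (\<lambda>x. F w x t)"
    and A_bound: "\<And>w x t. x \<in> \<Omega> \<Longrightarrow> t \<ge> 0 \<Longrightarrow> (A x t *v w) \<bullet> w \<le> - \<gamma> t * (norm w)\<^sup>2"
    and p_gt: "p > 1"
    and B_bound: "\<And>w x t. x \<in> \<Omega> \<Longrightarrow> t \<ge> 0 \<Longrightarrow> norm (B w x t) \<le> c0 t * norm w powr p"
    and compat: "\<And>y. y \<in> frontier \<Omega> \<Longrightarrow> has_normal_derivative \<Omega> u0 y 0"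
    and sol: "classical_neumann_solution \<Omega> D F u0 u"
    and u_H2: "\<And>t. t \<ge> 0 \<Longrightarrow> in_H2 \<Omega> (u t)"
    and g_eq: "\<And>t. g t = L2_norm \<Omega> (u t)"
    and g0: "g 0 \<noteq> 0"
    and c_pos: "c > 0"
    and c_embed: "\<And>v :: real^'m \<Rightarrow> real^'n. in_H2 \<Omega> v \<Longrightarrow>
        Linf_norm \<Omega> v \<le> ereal (c * L2_norm \<Omega> v powr (1/4) * H2_norm \<Omega> v powr (3/4))"
    and C_eq: "\<And>t. C t = c powr (p - 1) * H2_norm \<Omega> (u t) powr (3 * (p - 1) / 4)"
    and \<alpha>_eq: "\<And>t. \<alpha> t = C t * c0 t"
    and q_eq: "q = (p + 3) / 4"
    and \<gamma>_cont: "continuous_on {0..} \<gamma>"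
    and \<alpha>_cont: "continuous_on {0..} \<alpha>"
    and \<alpha>_nonneg: "\<And>t. t \<ge> 0 \<Longrightarrow> \<alpha> t \<ge> 0"
    and \<gamma>_eq: "\<And>t. t \<ge> 0 \<Longrightarrow> \<gamma> t = - \<gamma>0 / (t + 1) powr k"
    and \<mu>_eq: "\<And>t. t \<ge> 0 \<Longrightarrow> \<mu> t = \<mu>0 + \<mu>1 * (t + 1) powr (- \<nu>)"
    and consts_pos: "\<gamma>0 > 0" "\<mu>0 > 0" "\<mu>1 > 0" "\<nu> > 0"
    and \<nu>_k: "\<nu> + 1 \<le> k"
    and init: "\<mu>0 + \<mu>1 = inverse (g 0)"
    and \<alpha>_bound: "\<And>t. t \<ge> 0 \<Longrightarrow>
        \<alpha> t \<le> (\<mu>0 + \<mu>1 * (t + 1) powr (- \<nu>)) powr (q - 1) *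
          (\<nu> * \<mu>1 * (1 + t) powr (- \<nu> - 1) / (\<mu>0 + \<mu>1 * (t + 1) powr (- \<nu>)) - \<gamma>0 / (t + 1) powr k)"
    and C_bound: "\<And>t. t \<ge> 0 \<Longrightarrow>
        C t * (1 + t) powr (\<nu> + 1) * c0 t \<le> \<mu>0 powr (q - 1) * (\<nu> * \<mu>1 / \<mu>0 - \<gamma>0)"
  shows "\<forall>t\<ge>0. L2_norm \<Omega> (u t) \<le> inverse (\<mu> t) \<and> inverse (\<mu> t) \<le> inverse \<mu>0"
proof (intro allI impI)
  fix T :: real assume T: "T \<ge> 0"
  have dom1: "bounded_Ck_domain 1 \<Omega>" using dom by (rule bounded_Ck_domain_mono) simp
  have \<Omega>: "open \<Omega>" "bounded \<Omega>" using dom by (auto simp: bounded_Ck_domain_def)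
  obtain x0 where x0: "x0 \<in> \<Omega>" using dom by (auto simp: bounded_Ck_domain_def)
  define y where "y t = (\<integral>x. (norm (u t x))\<^sup>2 \<partial>lebesgue_on \<Omega>)" for t
  define y' where "y' t = (\<integral>x. 2 * (u t x \<bullet> vector_derivative (\<lambda>s. u s x) (at t)) \<partial>lebesgue_on \<Omega>)" for t
  \<comment> \<open>The formula for \<open>\<mu>\<close> on the whole line, so that it can be
    differentiated; the hypothesis fixes \<open>\<mu>\<close> only for nonnegative times.\<close>
  define m where "m t = \<mu>0 + \<mu>1 * (t + 1) powr (- \<nu>)" for t :: real
  define z where "z t = inverse (m t) ^ 2" for t :: real
  define z' where "z' t = 2 * (\<nu> * \<mu>1 * (1 + t) powr (- \<nu> - 1)) * inverse (m t) ^ 3" for t :: real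
  define s where "s = (q + 1) / 2"
  have s: "s \<ge> 1" "s = 1 + (p - 1) / 8" using p_gt by (auto simp: s_def q_eq field_simps)
  have m_pos: "m t > 0" and m_ge: "m t \<ge> \<mu>0" for t
    using consts_pos by (auto simp: m_def intro: add_pos_nonneg)
  have y0: "y t \<ge> 0" for t by (simp add: y_def)
  have gy: "L2_norm \<Omega> (u t) = sqrt (y t)" for t by (simp add: L2_norm_def y_def)
  have "y T \<le> z T"
  proof (rule power_law_comparison[where y = y and z = z and a = "\<lambda>t. - 2 * \<gamma> t" and b = "\<lambda>t. 2 * \<alpha> t" and y' = y' and z' = z'
        and s = s, OF s(1)])
    show "continuous_on {0..} y"
      unfolding y_def
    proof (rule continuous_on_integral_lebesgue_on[OF \<Omega>])
      have "continuous_on ({0..} \<times> closure \<Omega>) (\<lambda>(t, x). u t x)"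
        using sol by (simp add: classical_neumann_solution_def)
      then show "continuous_on ({0..} \<times> closure \<Omega>) (\<lambda>(t, x). (norm (u t x))\<^sup>2)"
        unfolding case_prod_beta by (intro continuous_intros)
    qed
    show "continuous_on {0..} z"
    proof -
      have "continuous_on {0..} m" unfolding m_def by (intro continuous_intros) auto
      moreover have "\<forall>t\<in>{0..}. m t \<noteq> 0" using m_pos by (metis less_irrefl)
      ultimately show ?thesis unfolding z_def by (intro continuous_intros)
    qed
    show "continuous_on {0..} (\<lambda>t. - 2 * \<gamma> t)" "continuous_on {0..} (\<lambda>t. 2 * \<alpha> t)"
      by (intro continuous_intros \<gamma>_cont \<alpha>_cont)+
    show "z t > 0" "2 * \<alpha> t \<ge> 0" if "t \<ge> 0" for t
      using m_pos[of t] \<alpha>_nonneg[OF that] by (auto simp: z_def)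
    show "(y has_real_derivative y' t) (at t)" if "t > 0" for t
      unfolding y_def y'_def by (rule energy_derivative[OF sol \<Omega> that])
    show "(z has_real_derivative z' t) (at t)" if t: "t > 0" for t
    proof -
      have "(m has_real_derivative - (\<nu> * \<mu>1 * (1 + t) powr (- \<nu> - 1))) (at t)"
        unfolding m_def using t by (auto intro!: derivative_eq_intros simp: add.commute)
      then show ?thesis
        unfolding z_def z'_def using m_pos[of t]
        by (auto intro!: derivative_eq_intros simp: power2_eq_square power3_eq_cube)
    qed
    show "y 0 \<le> z 0"
    proof -
      have "sqrt (y 0) = inverse (m 0)"
        using init g0 by (simp add: g_eq gy m_def)
      then have "(sqrt (y 0))\<^sup>2 = z 0" by (simp only: z_def)
      then show ?thesis using y0[of 0] by simp
    qed
    \<comment> \<open>With \<open>N\<close> standing for the negative of the derivative of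
      \<open>m\<close>, the bracket in the hypothesis on \<open>\<alpha>\<close> is
      \<open>N / m t + \<gamma> t\<close>. Multiplication by
      \<open>z t powr s = m t powr (- (q + 1))\<close> turns the factor
      \<open>m t powr (q - 1)\<close> into \<open>z t\<close>, and
      \<open>z' t = 2 * (z t * (N / m t))\<close>.\<close>
    show "z' t \<ge> - 2 * \<gamma> t * z t + 2 * \<alpha> t * z t powr s" if t: "t > 0" for t
    proof -
      define N where "N = \<nu> * \<mu>1 * (1 + t) powr (- \<nu> - 1)"
      have zs: "z t powr s = m t powr (- (q + 1))"
      proof -
        have "z t = m t powr (- 2)" using m_pos[of t] by (simp add: z_def powr_minus power_inverse)
        moreover have "- 2 * s = - (q + 1)" by (simp add: s_def)
        ultimately show ?thesis by (simp only: powr_powr)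
      qed
      have "\<alpha> t \<le> m t powr (q - 1) * (N / m t - \<gamma>0 / (t + 1) powr k)"
        unfolding m_def N_def by (rule \<alpha>_bound) (use t in simp)
      also have "N / m t - \<gamma>0 / (t + 1) powr k = N / m t + \<gamma> t"
        using t by (subst \<gamma>_eq) simp_all
      finally have "\<alpha> t \<le> m t powr (q - 1) * (N / m t + \<gamma> t)" .
      then have "\<alpha> t * z t powr s \<le> m t powr (q - 1) * (N / m t + \<gamma> t) * m t powr (- (q + 1))"
        unfolding zs by (rule mult_right_mono) simp
      also have "\<dots> = (m t powr (q - 1) * m t powr (- (q + 1))) * (N / m t + \<gamma> t)" by simp
      also have "m t powr (q - 1) * m t powr (- (q + 1)) = m t powr (- 2)"
        by (simp flip: powr_add)
      also have "m t powr (- 2) = z t"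
        using m_pos[of t] by (simp add: z_def powr_minus power_inverse)
      finally have "\<alpha> t * z t powr s \<le> z t * (N / m t) + \<gamma> t * z t" by (simp add: algebra_simps)
      moreover have "z' t = 2 * (z t * (N / m t))"
        by (simp add: z'_def z_def N_def power2_eq_square power3_eq_cube field_simps)
      ultimately show ?thesis by simp
    qed
    show "y' t \<le> - 2 * \<gamma> t * y t + 2 * \<alpha> t * y t powr s" if t: "t > 0" for t
    proof -
      let ?M = "lebesgue_on \<Omega>"
      let ?ut = "\<lambda>x. vector_derivative (\<lambda>s. u s x) (at t)"
      let ?diff = "\<lambda>x. u t x \<bullet> (D t *v laplacian (u t) x)"
      let ?reac = "\<lambda>x. u t x \<bullet> F (u t x) x t"
      have diff: "integrable ?M ?diff" "(\<integral>x. ?diff x \<partial>?M) \<le> 0"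
        using t diffusion_energy_nonpos[OF sol dom1 t D_diag D_pos F_bdd] by auto
      have sub: "\<Omega> \<subseteq> closure \<Omega>" by (rule closure_subset)
      have uc: "continuous_on (closure \<Omega>) (u t)" using t by (intro classical_neumann_solution_slice[OF sol]) simp
      have int_ut: "integrable ?M (\<lambda>x. u t x \<bullet> ?ut x)"
        by (rule energy_density_derivative_integrable[OF sol \<Omega> t])
      have uu: "continuous_on (closure \<Omega>) (\<lambda>x. (norm (u t x))\<^sup>2)" by (intro continuous_intros uc)
      have int_u2: "integrable ?M (\<lambda>x. (norm (u t x))\<^sup>2)"
        by (rule integrable_lebesgue_on_bounded[OF \<Omega> continuous_on_subset[OF uu sub] bounded_image_closure[OF \<Omega>(2) uu]])
      have split: "u t x \<bullet> ?ut x = ?diff x + ?reac x" if "x \<in> space ?M" for x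
        using sol t that by (simp add: classical_neumann_solution_def inner_add_right)
      have "integrable ?M (\<lambda>x. u t x \<bullet> ?ut x - ?diff x)"
        by (intro Bochner_Integration.integrable_diff int_ut diff)
      \<comment> \<open>The reaction term is integrable as the difference of two integrable
        functions, by the equation.\<close>
      then have reac: "integrable ?M ?reac"
        by (rule Bochner_Integration.integrable_cong[THEN iffD1, rotated -1]) (simp_all add: split)
      define K where "K = c * L2_norm \<Omega> (u t) powr (1/4) * H2_norm \<Omega> (u t) powr (3/4)"
      have K0: "K \<ge> 0" using c_pos by (simp add: K_def)
      have AE_K: "AE x in ?M. norm (u t x) \<le> K"
      proof -
        have "Linf_norm \<Omega> (u t) \<le> ereal K" unfolding K_def using t by (intro c_embed u_H2) simp
        then show ?thesis
          using esssup_AE[of "\<lambda>x. ereal (norm (u t x))" ?M] unfolding Linf_norm_def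
          by (auto elim!: eventually_mono dest: order_trans)
      qed
      \<comment> \<open>Test the growth bound for \<open>B\<close> on a unit vector. The sign of
        \<open>\<alpha>\<close> would not settle this at times when \<open>C\<close>
        vanishes.\<close>
      have c0: "c0 t \<ge> 0"
      proof -
        obtain w :: "real^'n" where "norm w = 1" using vector_choose_size[of 1] by auto
        then show ?thesis using B_bound[OF x0, of t w] t norm_ge_zero[of "B w x0 t"] by (simp del: norm_ge_zero)
      qed
      \<comment> \<open>The power \<open>p - 1\<close> of the interpolation bound splits into the
        factors defining \<open>C\<close> and the power \<open>(p - 1) / 4\<close> of the norm,
        which is \<open>y t powr ((p - 1) / 8)\<close> as the norm is the square root of
        \<open>y t\<close>.\<close>
      have \<alpha>K: "c0 t * K powr (p - 1) = \<alpha> t * y t powr ((p - 1) / 8)"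
      proof -
        have "sqrt (y t) = y t powr (1/2)" using y0[of t] by (simp add: powr_half_sqrt)
        then have "K powr (p - 1) = c powr (p - 1) * y t powr ((p - 1) / 8) * H2_norm \<Omega> (u t) powr (3 * (p - 1) / 4)"
          using c_pos y0[of t]
          by (simp add: K_def gy powr_mult powr_powr)
        then show ?thesis by (simp add: \<alpha>_eq C_eq)
      qed
      have "AE x in ?M. ?reac x \<le> (- \<gamma> t + c0 t * K powr (p - 1)) * (norm (u t x))\<^sup>2"
        using AE_K AE_space
      proof eventually_elim
        case (elim x)
        then have x: "x \<in> \<Omega>" by simp
        have "?reac x = (A x t *v u t x) \<bullet> u t x + u t x \<bullet> B (u t x) x t"
          by (simp add: F_eq inner_add_right inner_commute)
        also have "\<dots> \<le> - \<gamma> t * (norm (u t x))\<^sup>2 + norm (u t x) * (c0 t * norm (u t x) powr p)"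
        proof (intro add_mono)
          show "(A x t *v u t x) \<bullet> u t x \<le> - \<gamma> t * (norm (u t x))\<^sup>2" using A_bound x t by simp
          have "u t x \<bullet> B (u t x) x t \<le> norm (u t x) * norm (B (u t x) x t)" by (rule norm_cauchy_schwarz)
          also have "\<dots> \<le> norm (u t x) * (c0 t * norm (u t x) powr p)"
            using B_bound x t by (intro mult_left_mono) auto
          finally show "u t x \<bullet> B (u t x) x t \<le> norm (u t x) * (c0 t * norm (u t x) powr p)" .
        qed
        \<comment> \<open>Only \<open>p - 1\<close> of the \<open>p + 1\<close> factors are
          estimated by the essential supremum; the remaining square integrates to
          \<open>y t\<close>.\<close>
        also have "norm (u t x) * (c0 t * norm (u t x) powr p) = c0 t * norm (u t x) powr (p - 1) * (norm (u t x))\<^sup>2"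
        proof (cases "u t x = 0")
          case False
          then have "norm (u t x) powr p = norm (u t x) powr (p - 1) * norm (u t x)"
            by (simp add: powr_diff)
          then show ?thesis by (simp add: power2_eq_square)
        qed simp
        also have "\<dots> \<le> c0 t * K powr (p - 1) * (norm (u t x))\<^sup>2"
          using elim(1) c0 p_gt by (intro mult_right_mono mult_left_mono powr_mono2) auto
        finally show ?case by (simp add: algebra_simps)
      qed
      then have "(\<integral>x. ?reac x \<partial>?M) \<le> (\<integral>x. (- \<gamma> t + c0 t * K powr (p - 1)) * (norm (u t x))\<^sup>2 \<partial>?M)"
        by (intro integral_mono_AE reac integrable_mult_right int_u2)
      also have "\<dots> = (- \<gamma> t + \<alpha> t * y t powr ((p - 1) / 8)) * y t"
        unfolding \<alpha>K by (simp only: y_def integral_mult_right_zero)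
      also have "\<dots> = - \<gamma> t * y t + \<alpha> t * (y t * y t powr ((p - 1) / 8))"
        by (simp add: algebra_simps)
      also have "y t * y t powr ((p - 1) / 8) = y t powr s"
        using y0[of t] by (simp add: s powr_mult_base)
      finally have reac_le: "(\<integral>x. ?reac x \<partial>?M) \<le> - \<gamma> t * y t + \<alpha> t * y t powr s" .
      have "y' t = 2 * (\<integral>x. ?diff x + ?reac x \<partial>?M)"
        unfolding y'_def by (subst integral_mult_right_zero) (intro arg_cong2[where f = times] refl Bochner_Integration.integral_cong split)
      also have "\<dots> = 2 * (\<integral>x. ?diff x \<partial>?M) + 2 * (\<integral>x. ?reac x \<partial>?M)"
        using diff(1) reac by simp
      finally show ?thesis using diff(2) reac_le by simp
    qed
  qed (use T in auto)
  then have "sqrt (y T) \<le> sqrt (z T)" by simp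
  also have "sqrt (z T) = inverse (\<mu> T)"
    using m_pos[of T] T by (simp add: z_def m_def \<mu>_eq)
  finally have "L2_norm \<Omega> (u T) \<le> inverse (\<mu> T)" by (simp only: gy)
  moreover have "inverse (m T) \<le> inverse \<mu>0"
    using m_ge[of T] consts_pos by (intro le_imp_inverse_le) auto
  ultimately show "L2_norm \<Omega> (u T) \<le> inverse (\<mu> T) \<and> inverse (\<mu> T) \<le> inverse \<mu>0"
    using T by (simp add: \<mu>_eq m_def)
qed

end
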